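(* Let $n\ge 1$ be an integer. For $l \ge 1$ let $\mathcal{R}_l$ be the finite set of group presentations $\langle x_1,\dots,x_{n+1}\mid r_1,\dots,r_n\rangle$ in which each $r_i$ is a non-empty cyclically reduced word of length at most $l$ in the alphabet $\{x_1^{\pm1},\dots,x_{n+1}^{\pm1}\}$. Then a random group of deficiency 1 (in this few-relator model) is not subgroup separable with positive asymptotic probability, i.e. $$\liminf_{l\to\infty}\frac{\#\{\text{presentations in }\mathcal{R}_l\text{ whose group is not subgroup separable}\}}{\#\mathcal{R}_l}>0 .$$
   Context: A group $G$ is subgroup separable (LERF) if every finitely generated subgroup $H \le G$ is an intersection of finite index subgroups of $G$. Presentations in $\mathcal{R}_l$ are identified with ordered $n$-tuples $(r_1,\dots,r_n)$ of words. *)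

theory Defs
  imports "HOL-Algebra.Generated_Groups" "HOL-Library.Extended_Real"
begin

text \<open>
  The letter \<open>(x, True)\<close> stands for the generator \<open>x\<close>, and \<open>(x, False)\<close> for its formal inverse.
\<close>

type_synonym 'x letter = "'x \<times> bool"
type_synonym 'x word = "'x letter list"

definition inv_letter :: "'x letter \<Rightarrow> 'x letter" where
  "inv_letter a = (fst a, \<not> snd a)"

definition letters :: "'x set \<Rightarrow> 'x letter set" where
  "letters X = X \<times> UNIV"

definition reduced :: "'x word \<Rightarrow> bool" where
  "reduced w \<longleftrightarrow> successively (\<lambda>a b. b \<noteq> inv_letter a) w"

definition cyclically_reduced :: "'x word \<Rightarrow> bool" where
  "cyclically_reduced w \<longleftrightarrow> reduced w \<and> (w \<noteq> [] \<longrightarrow> hd w \<noteq> inv_letter (last w))"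

text \<open>
  The free group on \<open>X\<close>: reduced words in \<open>X\<close> and their inverses, multiplied by
  concatenation followed by free reduction. On reduced words, prepending one letter causes at most
  one cancellation.
\<close>

fun free_cons :: "'x letter \<Rightarrow> 'x word \<Rightarrow> 'x word" where
  "free_cons a [] = [a]"
| "free_cons a (b # w) = (if b = inv_letter a then w else a # b # w)"

definition free_mult :: "'x word \<Rightarrow> 'x word \<Rightarrow> 'x word" where
  "free_mult u v = foldr free_cons u v"

definition free_group :: "'x set \<Rightarrow> 'x word monoid" where
  "free_group X = \<lparr>carrier = {w \<in> lists (letters X). reduced w}, mult = free_mult, one = []\<rparr>"

definition normal_closure :: "('a, 'b) monoid_scheme \<Rightarrow> 'a set \<Rightarrow> 'a set" where
  "normal_closure G R = \<Inter> {N. N \<lhd> G \<and> R \<subseteq> N}"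

text \<open>The relators are meant to be reduced words, so that they are elements of the free group.\<close>

definition presented_group :: "'x set \<Rightarrow> 'x word set \<Rightarrow> 'x word set monoid" where
  "presented_group X R = free_group X Mod normal_closure (free_group X) R"

definition finitely_generated_subgroup :: "'a set \<Rightarrow> ('a, 'b) monoid_scheme \<Rightarrow> bool" where
  "finitely_generated_subgroup H G \<longleftrightarrow>
     (\<exists>S. finite S \<and> S \<subseteq> carrier G \<and> H = generate G S)"

definition finite_index_subgroup :: "'a set \<Rightarrow> ('a, 'b) monoid_scheme \<Rightarrow> bool" where
  "finite_index_subgroup K G \<longleftrightarrow> subgroup K G \<and> finite (rcosets\<^bsub>G\<^esub> K)"

text \<open>
  Non-emptiness of the family only excludes the junk value \<open>\<Inter> {} = UNIV\<close>; the whole group is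
  itself a finite index subgroup.
\<close>

definition subgroup_separable :: "('a, 'b) monoid_scheme \<Rightarrow> bool" where
  "subgroup_separable G \<longleftrightarrow>
     (\<forall>H. finitely_generated_subgroup H G \<longrightarrow>
        (\<exists>\<K>. \<K> \<noteq> {} \<and> (\<forall>K\<in>\<K>. finite_index_subgroup K G) \<and> H = \<Inter>\<K>))"

text \<open>
  The few-relator model with \<open>m\<close> generators and \<open>n\<close> relators: a presentation is its tuple of
  relators, as a list of length \<open>n\<close>, so that order and repetitions count.
\<close>

definition relators :: "nat \<Rightarrow> nat \<Rightarrow> nat word set" where
  "relators m l =
     {w \<in> lists (letters {1..m}). w \<noteq> [] \<and> cyclically_reduced w \<and> length w \<le> l}"

definition presentations :: "nat \<Rightarrow> nat \<Rightarrow> nat \<Rightarrow> nat word list set" where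
  "presentations m n l = {rs. length rs = n \<and> set rs \<subseteq> relators m l}"

lemma inv_letter_inv_letter [simp]: "inv_letter (inv_letter a) = a"
  by (simp add: inv_letter_def)

lemma inv_letter_in_letters [simp]: "inv_letter a \<in> letters X \<longleftrightarrow> a \<in> letters X"
  by (cases a) (auto simp: inv_letter_def letters_def)

lemma reduced_Nil [simp]: "reduced []"
  by (simp add: reduced_def)

lemma reduced_free_cons: "reduced w \<Longrightarrow> reduced (free_cons a w)"
  by (cases w) (auto simp: reduced_def successively_Cons)

lemma free_cons_inv_letter: "reduced w \<Longrightarrow> free_cons a (free_cons (inv_letter a) w) = w"
  by (cases w rule: remdups_adj.cases) (auto simp: reduced_def)

lemma free_cons_reduced: "reduced (a # w) \<Longrightarrow> free_cons a w = a # w"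
  by (cases w) (auto simp: reduced_def)

lemma reduced_free_mult: "reduced v \<Longrightarrow> reduced (free_mult u v)"
  by (induction u) (auto simp: free_mult_def reduced_free_cons)

lemma free_mult_Nil: "reduced u \<Longrightarrow> free_mult u [] = u"
proof (induction u)
  case (Cons a u)
  then have "reduced u" by (auto simp: reduced_def successively_Cons)
  with Cons show ?case by (simp add: free_mult_def free_cons_reduced)
qed (simp add: free_mult_def)

lemma free_mult_free_cons:
  assumes "reduced w"
  shows "free_mult (free_cons a v) w = free_cons a (free_mult v w)"
proof (cases v)
  case (Cons b v')
  have "reduced (free_mult v' w)" by (rule reduced_free_mult[OF assms])
  with Cons show ?thesis
    by (auto simp: free_mult_def free_cons_inv_letter)
qed (simp add: free_mult_def)

lemma free_mult_assoc:
  assumes "reduced w"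
  shows "free_mult (free_mult u v) w = free_mult u (free_mult v w)"
proof (induction u)
  case (Cons a u)
  have "free_mult (free_mult (a # u) v) w = free_mult (free_cons a (free_mult u v)) w"
    by (simp add: free_mult_def)
  also have "\<dots> = free_cons a (free_mult u (free_mult v w))"
    by (simp add: free_mult_free_cons assms Cons)
  finally show ?case by (simp add: free_mult_def)
qed (simp add: free_mult_def)

lemma free_mult_left_inverse:
  "reduced v \<Longrightarrow> free_mult (rev (map inv_letter u)) (free_mult u v) = v"
proof (induction u)
  case (Cons a u)
  have "free_cons (inv_letter a) (free_cons a (free_mult u v)) = free_mult u v"
    using free_cons_inv_letter[of "free_mult u v" "inv_letter a"] reduced_free_mult[OF Cons.prems]
    by simp
  with Cons show ?case by (simp add: free_mult_def)
qed (simp add: free_mult_def)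

lemma free_cons_in_lists: "a \<in> A \<Longrightarrow> w \<in> lists A \<Longrightarrow> free_cons a w \<in> lists A"
  by (cases w) auto

lemma free_mult_in_lists: "u \<in> lists A \<Longrightarrow> v \<in> lists A \<Longrightarrow> free_mult u v \<in> lists A"
proof (induction u)
  case (Cons a u)
  then have "free_mult u v \<in> lists A" "a \<in> A"
    by auto
  then have "free_cons a (free_mult u v) \<in> lists A"
    by (intro free_cons_in_lists)
  then show ?case
    by (simp add: free_mult_def)
qed (simp add: free_mult_def)

lemma group_free_group: "group (free_group X)"
proof (rule groupI)
  fix u v assume "u \<in> carrier (free_group X)" "v \<in> carrier (free_group X)"
  then show "u \<otimes>\<^bsub>free_group X\<^esub> v \<in> carrier (free_group X)"
    using free_mult_in_lists[of u "letters X" v] by (simp add: free_group_def reduced_free_mult)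
next
  fix u assume u: "u \<in> carrier (free_group X)"
  let ?v = "free_mult (rev (map inv_letter u)) []"
  have "rev (map inv_letter u) \<in> lists (letters X)"
    using u by (auto simp: free_group_def)
  then have "?v \<in> lists (letters X)"
    by (rule free_mult_in_lists) simp
  then have "?v \<in> carrier (free_group X)"
    by (simp add: free_group_def reduced_free_mult)
  moreover have "free_mult ?v u = free_mult (rev (map inv_letter u)) u"
    using u by (simp add: free_group_def free_mult_assoc) (simp add: free_mult_def)
  then have "free_mult ?v u = []"
    using u free_mult_left_inverse[of "[]" u] by (simp add: free_group_def free_mult_Nil)
  ultimately show "\<exists>v\<in>carrier (free_group X). v \<otimes>\<^bsub>free_group X\<^esub> u = \<one>\<^bsub>free_group X\<^esub>"
    by (intro bexI[of _ ?v]) (simp_all add: free_group_def)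
next
  fix u assume "u \<in> carrier (free_group X)"
  then show "\<one>\<^bsub>free_group X\<^esub> \<otimes>\<^bsub>free_group X\<^esub> u = u"
    by (simp add: free_group_def) (simp add: free_mult_def)
qed (simp_all add: free_group_def free_mult_assoc)

lemma (in group) normal_closure_normal:
  assumes "R \<subseteq> carrier G"
  shows "normal_closure G R \<lhd> G" "R \<subseteq> normal_closure G R"
proof -
  let ?F = "{N. N \<lhd> G \<and> R \<subseteq> N}"
  have "carrier G \<in> ?F"
    using assms normal_self by auto
  then have "subgroup (\<Inter>?F) G"
    by (intro subgroups_Inter) (auto simp: normal_imp_subgroup)
  then show "normal_closure G R \<lhd> G"
    unfolding normal_closure_def normal_inv_iff by (auto simp: normal_inv_iff)
  show "R \<subseteq> normal_closure G R"
    by (auto simp: normal_closure_def)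
qed

lemma group_presented_group:
  assumes "R \<subseteq> carrier (free_group X)"
  shows "group (presented_group X R)"
  unfolding presented_group_def
  using group.normal_closure_normal(1)[OF group_free_group assms] by (rule normal.factorgroup_is_group)

lemma relators_subset_free_group: "relators m l \<subseteq> carrier (free_group {1..m})"
  by (auto simp: relators_def free_group_def cyclically_reduced_def)

lemma finite_presentations: "finite (presentations m n l)"
proof -
  have "relators m l \<subseteq> {w. set w \<subseteq> letters {1..m} \<and> length w \<le> l}"
    by (auto simp: relators_def)
  moreover have "finite (letters {1..m})"
    by (simp add: letters_def)
  ultimately have "finite (relators m l)"
    using finite_lists_length_le finite_subset by fast
  from finite_lists_length_eq[OF this] show ?thesis
    by (simp add: presentations_def conj_commute)
qed

end

theory Submission
  imports Defs
begin

text \<open>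
  A nonzero integer grading \<open>c\<close> of the free group that kills all \<open>n\<close> relators exists by linear
  algebra; choose a generator \<open>t\<close> of positive degree and pair the relators with the other generators.
  Into the relator paired with \<open>x\<close> insert, with \<open>y = x\<^sup>\<plusminus>\<^sup>1\<close> of degree \<open>\<ge> 0\<close>, the commutator
  \<open>y t y\<^sup>-\<^sup>1 t\<^sup>-\<^sup>1\<close> at the first point of maximal height and the square of \<open>y\<^sup>-\<^sup>1 t\<^sup>-\<^sup>1 y t\<close> at the first
  point of minimal height. This lengthens every relator by 12 and changes no abelianization, so \<open>c\<close>
  and \<open>t\<close> can be read off from the result, and so can the insertion points. The modification is
  therefore injective, and the modified presentations have positive lower density.

  In a modified presentation let \<open>H\<close> be the finitely generated subgroup of loops with heights in
  \<open>{0..N}\<close>. The unique maxima of the relators allow one to push the loops of \<open>t H t\<^sup>-\<^sup>1\<close> down into \<open>H\<close>.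
  The inclusion is strict: because of the coefficient 2 at the minima, one can solve, downwards
  from height 0, for a cochain with values in \<open>\<real> / \<int>\<close> that vanishes on the relators and at positive
  heights but not on some commutator in \<open>H\<close>. Finally, \<open>t H t\<^sup>-\<^sup>1 \<subset> H\<close> is incompatible with
  separability, since a subgroup of finite index contains a positive power of \<open>t\<close>.
\<close>

section \<open>Heights and cochains\<close>

definition weight :: "('x \<Rightarrow> int) \<Rightarrow> 'x letter \<Rightarrow> int" where
  "weight c a = (if snd a then c (fst a) else - c (fst a))"

definition height :: "('x \<Rightarrow> int) \<Rightarrow> 'x word \<Rightarrow> int" where
  "height c w = sum_list (map (weight c) w)"

definition winv :: "'x word \<Rightarrow> 'x word" where
  "winv w = rev (map inv_letter w)"

text \<open>The integers are the vertices of a graph with an \<open>x\<close>-edge from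
  \<open>h\<close> to \<open>h + c x\<close> for every \<open>h\<close>. A word traces a path in
  this graph; collected here are the vertices that the path from \<open>h\<close> visits.\<close>

fun heights :: "('x \<Rightarrow> int) \<Rightarrow> int \<Rightarrow> 'x word \<Rightarrow> int set" where
  "heights c h [] = {h}"
| "heights c h (a # w) = insert h (heights c (h + weight c a) w)"

text \<open>The integral of the cochain \<open>f\<close> along that path. An edge is named by its
  label and its lower endpoint, hence the \<open>min\<close>: both directions of traversal read the
  same value of \<open>f\<close>, with opposite signs.\<close>

fun pairing :: "('x \<Rightarrow> int) \<Rightarrow> ('x \<Rightarrow> int \<Rightarrow> real) \<Rightarrow> int \<Rightarrow> 'x word \<Rightarrow> real" where
  "pairing c f h [] = 0"
| "pairing c f h (a # w) =
     (if snd a then 1 else -1) * f (fst a) (min h (h + weight c a)) + pairing c f (h + weight c a) w"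

lemma inv_letter_neq [simp]: "inv_letter a \<noteq> a" "a \<noteq> inv_letter a"
  by (cases a; simp add: inv_letter_def)+

lemma fst_inv_letter [simp]: "fst (inv_letter a) = fst a"
  by (simp add: inv_letter_def)

lemma snd_inv_letter [simp]: "snd (inv_letter a) \<longleftrightarrow> \<not> snd a"
  by (simp add: inv_letter_def)

lemma weight_inv_letter [simp]: "weight c (inv_letter a) = - weight c a"
  by (simp add: weight_def)

lemma weight_uminus [simp]: "weight (\<lambda>x. - c x) a = - weight c a"
  by (simp add: weight_def)

lemma height_simps [simp]:
  "height c [] = 0" "height c (a # w) = weight c a + height c w"
  "height c (u @ v) = height c u + height c v"
  by (simp_all add: height_def)

lemma height_uminus [simp]: "height (\<lambda>x. - c x) w = - height c w"
  by (induction w) auto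

lemma winv_simps [simp]:
  "winv [] = []" "winv (a # w) = winv w @ [inv_letter a]" "winv (u @ v) = winv v @ winv u"
  "winv (winv w) = w"
  by (simp_all add: winv_def rev_map comp_def)

lemma winv_in_lists [simp]: "winv w \<in> lists (letters X) \<longleftrightarrow> w \<in> lists (letters X)"
  by (induction w) auto

lemma height_winv [simp]: "height c (winv w) = - height c w"
  by (induction w) auto

lemma start_in_heights [simp]: "h \<in> heights c h w"
  by (cases w) auto

lemma heights_append: "heights c h (u @ v) = heights c h u \<union> heights c (h + height c u) v"
  by (induction u arbitrary: h) (auto simp: add.assoc)

lemma end_in_heights: "h + height c w \<in> heights c h w"
  by (induction w arbitrary: h) (auto simp: add.assoc[symmetric])

lemma heights_winv: "heights c (h + height c w) (winv w) = heights c h w"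
proof (induction w arbitrary: h)
  case (Cons a w)
  have "h + weight c a \<in> heights c (h + weight c a) w" by simp
  then show ?case
    using Cons[of "h + weight c a"] by (auto simp: heights_append add.assoc)
qed simp

lemma heights_shift: "k \<in> heights c h w \<longleftrightarrow> k - h \<in> heights c 0 w"
proof (induction w arbitrary: h k)
  case (Cons a w)
  show ?case
    using Cons[of k "h + weight c a"] Cons[of "k - h" "weight c a"]
    by (simp add: algebra_simps)
qed auto

lemma heights_uminus: "heights (\<lambda>x. - c x) h w = uminus ` heights c (- h) w"
  by (induction w arbitrary: h) auto

lemma finite_heights [simp]: "finite (heights c h w)"
  by (induction w arbitrary: h) auto

lemma pairing_append: "pairing c f h (u @ v) = pairing c f h u + pairing c f (h + height c u) v"
  by (induction u arbitrary: h) (auto simp: add.assoc)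

lemma pairing_winv: "pairing c f (h + height c w) (winv w) = - pairing c f h w"
proof (induction w arbitrary: h)
  case (Cons a w)
  show ?case
    using Cons[of "h + weight c a"] by (auto simp: pairing_append add.assoc min.commute)
qed simp

lemma pairing_cong:
  assumes "heights c h w \<subseteq> {m..}" "\<And>x k. k \<ge> m \<Longrightarrow> f x k = g x k"
  shows "pairing c f h w = pairing c g h w"
  using assms(1)
proof (induction w arbitrary: h)
  case (Cons a w)
  then have "h \<ge> m" "heights c (h + weight c a) w \<subseteq> {m..}" by auto
  moreover from this have "h + weight c a \<ge> m"
    using start_in_heights by blast
  ultimately show ?case
    using Cons.IH by (simp add: assms(2))
qed simp

lemma pairing_zero: "pairing c (\<lambda>_ _. 0) h w = 0"
  by (induction w arbitrary: h) auto

lemma height_free_cons [simp]: "height c (free_cons a w) = weight c a + height c w"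
  by (cases w) auto

text \<open>A cancelling pair crosses one edge back and forth and contributes zero, so integration
  is blind to free reduction.\<close>

lemma pairing_free_cons:
  "pairing c f h (free_cons a w) = pairing c f h (a # w)"
  by (cases w) (auto simp: min.commute)

lemma height_free_mult [simp]: "height c (free_mult u v) = height c u + height c v"
  by (induction u) (auto simp: free_mult_def)

lemma pairing_free_mult: "pairing c f h (free_mult u v) = pairing c f h (u @ v)"
proof (induction u arbitrary: h)
  case (Cons a u)
  then show ?case
    by (simp add: free_mult_def pairing_free_cons)
qed (simp add: free_mult_def)

section \<open>Words as elements of a presented group\<close>

text \<open>\<open>free_mult w []\<close> is the free reduction of \<open>w\<close>. Arbitrary words
  can thus be evaluated in the quotient, and paths can be cut and joined without reducing
  them.\<close>

definition word_class :: "'x set \<Rightarrow> 'x word set \<Rightarrow> 'x word \<Rightarrow> 'x word set" where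
  "word_class X R w = normal_closure (free_group X) R #>\<^bsub>free_group X\<^esub> free_mult w []"

lemma free_group_simps:
  "w \<in> carrier (free_group X) \<longleftrightarrow> w \<in> lists (letters X) \<and> reduced w"
  "u \<otimes>\<^bsub>free_group X\<^esub> v = free_mult u v" "\<one>\<^bsub>free_group X\<^esub> = []"
  by (auto simp: free_group_def)

lemma free_mult_Nil_in_free_group:
  "w \<in> lists (letters X) \<Longrightarrow> free_mult w [] \<in> carrier (free_group X)"
  by (simp add: free_group_simps reduced_free_mult free_mult_in_lists)

lemma inv_free_group:
  assumes "w \<in> carrier (free_group X)"
  shows "inv\<^bsub>free_group X\<^esub> w = free_mult (winv w) []"
proof (rule group.inv_equality[OF group_free_group _ assms])
  have "free_mult (free_mult (winv w) []) w = free_mult (winv w) w"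
    using assms by (simp add: free_mult_assoc free_group_simps) (simp add: free_mult_def)
  also have "\<dots> = []"
    using free_mult_left_inverse[of "[]" w] assms
    by (simp add: winv_def free_mult_Nil free_group_simps)
  finally show "free_mult (winv w) [] \<otimes>\<^bsub>free_group X\<^esub> w = \<one>\<^bsub>free_group X\<^esub>"
    by (simp add: free_group_simps)
  show "free_mult (winv w) [] \<in> carrier (free_group X)"
    using assms by (intro free_mult_Nil_in_free_group) (simp add: free_group_simps)
qed

context
  fixes X :: "'x set" and R :: "'x word set"
  assumes R: "R \<subseteq> carrier (free_group X)"
begin

interpretation F: group "free_group X" by (rule group_free_group)
interpretation N: normal "normal_closure (free_group X) R" "free_group X"
  by (rule F.normal_closure_normal(1)[OF R])
interpretation G: group "presented_group X R" by (rule group_presented_group[OF R])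

lemma word_class_closed: "w \<in> lists (letters X) \<Longrightarrow> word_class X R w \<in> carrier (presented_group X R)"
  unfolding word_class_def presented_group_def FactGroup_def
  using free_mult_Nil_in_free_group[of w X] by (auto simp: RCOSETS_def)

lemma word_class_append:
  assumes "u \<in> lists (letters X)" "v \<in> lists (letters X)"
  shows "word_class X R (u @ v) = word_class X R u \<otimes>\<^bsub>presented_group X R\<^esub> word_class X R v"
proof -
  have "free_mult (u @ v) [] = free_mult u (free_mult v [])"
    by (simp add: free_mult_def)
  also have "\<dots> = free_mult (free_mult u []) (free_mult v [])"
    by (simp add: free_mult_assoc reduced_free_mult) (simp add: free_mult_def)
  finally show ?thesis
    using free_mult_Nil_in_free_group[OF assms(1)] free_mult_Nil_in_free_group[OF assms(2)]
    by (simp add: word_class_def presented_group_def FactGroup_def N.rcos_sum free_group_simps)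
qed

lemma word_class_eq_one_iff:
  assumes "w \<in> lists (letters X)"
  shows "word_class X R w = \<one>\<^bsub>presented_group X R\<^esub> \<longleftrightarrow>
    free_mult w [] \<in> normal_closure (free_group X) R"
proof -
  have v: "free_mult w [] \<in> carrier (free_group X)"
    by (rule free_mult_Nil_in_free_group[OF assms])
  have "\<one>\<^bsub>presented_group X R\<^esub> = normal_closure (free_group X) R"
    by (simp add: presented_group_def FactGroup_def)
  then show ?thesis
    unfolding word_class_def
    using F.coset_join1[OF _ v N.subgroup_axioms] F.coset_join2[OF v N.subgroup_axioms] by metis
qed

lemma word_class_Nil: "word_class X R [] = \<one>\<^bsub>presented_group X R\<^esub>"
  using N.one_closed by (subst word_class_eq_one_iff) (simp_all add: free_mult_def free_group_simps(3))

lemma word_class_cancel: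
  assumes "a \<in> letters X"
  shows "word_class X R [a, inv_letter a] = \<one>\<^bsub>presented_group X R\<^esub>"
proof -
  have "word_class X R [a, inv_letter a] = word_class X R []"
    by (simp add: word_class_def free_mult_def)
  then show ?thesis by (simp add: word_class_Nil)
qed

lemma word_class_relator:
  assumes "r \<in> R"
  shows "word_class X R r = \<one>\<^bsub>presented_group X R\<^esub>"
proof -
  have "r \<in> carrier (free_group X)" using R assms by blast
  then have "r \<in> lists (letters X)" "reduced r" by (simp_all add: free_group_simps(1))
  then show ?thesis
    using F.normal_closure_normal(2)[OF R] assms
    by (auto simp: word_class_eq_one_iff free_mult_Nil)
qed

lemma word_class_winv:
  assumes "w \<in> lists (letters X)"
  shows "word_class X R (winv w) = inv\<^bsub>presented_group X R\<^esub> word_class X R w"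
proof (rule G.inv_equality[symmetric])
  show "word_class X R (winv w) \<otimes>\<^bsub>presented_group X R\<^esub> word_class X R w = \<one>\<^bsub>presented_group X R\<^esub>"
    using assms
  proof (induction w)
    case (Cons a w)
    then have *: "a \<in> letters X" "w \<in> lists (letters X)" by auto
    have "word_class X R (winv (a # w)) \<otimes>\<^bsub>presented_group X R\<^esub> word_class X R (a # w) =
        word_class X R (winv w @ [inv_letter a, inv_letter (inv_letter a)] @ w)"
      using * by (subst word_class_append[symmetric]) auto
    also have "\<dots> = word_class X R (winv w) \<otimes>\<^bsub>presented_group X R\<^esub> word_class X R w"
      using * word_class_cancel[of "inv_letter a"] word_class_closed[of w]
      by (subst word_class_append, simp, simp, subst word_class_append) auto
    finally show ?case using Cons.IH * by simp
  qed (simp add: word_class_Nil)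
qed (use assms word_class_closed in auto)

text \<open>The elements of height 0 on which \<open>f\<close> integrates to an integer form a
  normal subgroup that contains \<open>R\<close>, hence also its normal closure.\<close>

lemma pairing_in_Ints_if_trivial:
  assumes rel: "\<And>r. r \<in> R \<Longrightarrow> height c r = 0" "\<And>r h. r \<in> R \<Longrightarrow> pairing c f h r \<in> \<int>"
    and w: "w \<in> lists (letters X)" "word_class X R w = \<one>\<^bsub>presented_group X R\<^esub>"
  shows "pairing c f h w \<in> \<int>"
proof -
  \<comment> \<open>All starting heights are required, because conjugation by \<open>g\<close> moves
    the starting height by \<open>height c g\<close>.\<close>
  define K where "K = {w \<in> carrier (free_group X). height c w = 0 \<and> (\<forall>h. pairing c f h w \<in> \<int>)}"
  have inv: "height c (inv\<^bsub>free_group X\<^esub> u) = - height c u"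
      "pairing c f h (inv\<^bsub>free_group X\<^esub> u) = - pairing c f (h - height c u) u"
    if "u \<in> carrier (free_group X)" for u h
    using that pairing_winv[of c f "h - height c u" u]
    by (simp_all add: inv_free_group pairing_free_mult)
  have "subgroup K (free_group X)"
  proof (rule F.subgroupI)
    have "[] \<in> K" by (auto simp: K_def free_group_simps)
    then show "K \<noteq> {}" by auto
  next
    fix u v assume "u \<in> K" "v \<in> K"
    then show "u \<otimes>\<^bsub>free_group X\<^esub> v \<in> K"
      using F.m_closed[of u v] by (auto simp: K_def free_group_simps pairing_free_mult pairing_append)
  next
    fix u assume "u \<in> K"
    then show "inv\<^bsub>free_group X\<^esub> u \<in> K"
      using F.inv_closed[of u] by (auto simp: K_def inv)
  qed (auto simp: K_def)
  moreover have "g \<otimes>\<^bsub>free_group X\<^esub> u \<otimes>\<^bsub>free_group X\<^esub> inv\<^bsub>free_group X\<^esub> g \<in> K"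
    if "g \<in> carrier (free_group X)" "u \<in> K" for g u
  proof -
    have u: "u \<in> carrier (free_group X)" "height c u = 0" "\<And>h. pairing c f h u \<in> \<int>"
      using that by (auto simp: K_def)
    have "g \<otimes>\<^bsub>free_group X\<^esub> u \<otimes>\<^bsub>free_group X\<^esub> inv\<^bsub>free_group X\<^esub> g \<in> carrier (free_group X)"
      using that u by simp
    moreover have "height c (g \<otimes>\<^bsub>free_group X\<^esub> u \<otimes>\<^bsub>free_group X\<^esub> inv\<^bsub>free_group X\<^esub> g) = 0"
      using that u by (simp add: free_group_simps(2) inv)
    moreover have "pairing c f h (g \<otimes>\<^bsub>free_group X\<^esub> u \<otimes>\<^bsub>free_group X\<^esub> inv\<^bsub>free_group X\<^esub> g) =
        pairing c f (h + height c g) u" for h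
      using that u by (simp add: free_group_simps(2) pairing_free_mult pairing_append inv)
    ultimately show ?thesis using u(3) by (simp add: K_def)
  qed
  ultimately have "K \<lhd> free_group X"
    by (simp add: F.normal_inv_iff)
  moreover have "R \<subseteq> K" using rel R by (auto simp: K_def)
  ultimately have "normal_closure (free_group X) R \<subseteq> K"
    by (auto simp: normal_closure_def)
  then have "free_mult w [] \<in> K" using w by (auto simp: word_class_eq_one_iff)
  then show ?thesis by (simp add: K_def pairing_free_mult)
qed

end

section \<open>Ascending subgroups\<close>

text \<open>Let H be generated by \<open>S\<close>. The subgroup t H t^-1 is finitely generated and
  misses \<open>g\<close>, but every finite index subgroup \<open>K\<close> above it contains
  \<open>g\<close>: some t^e with e > 0 lies in \<open>K\<close>, and so does t^e g t^-e.\<close>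

lemma (in group) not_subgroup_separable_ascending:
  assumes S: "finite S" "S \<subseteq> carrier G" and t: "t \<in> carrier G"
    and up: "\<And>h. h \<in> generate G S \<Longrightarrow> t \<otimes> h \<otimes> inv t \<in> generate G S"
    and g: "g \<in> generate G S" and strict: "inv t \<otimes> g \<otimes> t \<notin> generate G S"
  shows "\<not> subgroup_separable G"
proof
  assume sep: "subgroup_separable G"
  define conj where "conj h = t \<otimes> h \<otimes> inv t" for h
  have Hc: "h \<in> carrier G" if "h \<in> generate G S" for h
    using that generate_in_carrier S by blast
  have hom: "group_hom G G conj"
    unfolding conj_def
    by (unfold_locales) (use t in \<open>auto simp: hom_def m_assoc inv_solve_left\<close>)
  then have gen: "generate G (conj ` S) = conj ` generate G S"
    using group_hom.generate_img S by metis
  have "finitely_generated_subgroup (generate G (conj ` S)) G"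
    unfolding finitely_generated_subgroup_def
    using S t by (intro exI[of _ "conj ` S"]) (auto simp: conj_def)
  with sep obtain \<K> where "\<forall>K\<in>\<K>. finite_index_subgroup K G" "generate G (conj ` S) = \<Inter>\<K>"
    unfolding subgroup_separable_def by meson
  then have K: "K \<in> \<K> \<Longrightarrow> finite_index_subgroup K G" "conj ` generate G S = \<Inter>\<K>" for K
    by (simp_all add: gen)
  have "g \<in> K" if KK: "K \<in> \<K>" for K
  proof -
    interpret K: subgroup K G using K(1)[OF KK] by (simp add: finite_index_subgroup_def)
    have "finite (rcosets K)" using K(1)[OF KK] by (simp add: finite_index_subgroup_def)
    moreover have "range (\<lambda>i::nat. K #> (t [^] i)) \<subseteq> rcosets K"
      using t by (auto simp: RCOSETS_def)
    ultimately have "\<not> inj (\<lambda>i::nat. K #> (t [^] i))"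
      using finite_subset range_inj_infinite by blast
    then obtain i j :: nat where ij: "i < j" "K #> (t [^] i) = K #> (t [^] j)"
      unfolding inj_def by (metis linorder_neqE_nat)
    define e where "e = j - i"
    have "t [^] j = t [^] e \<otimes> t [^] i"
      using ij t by (simp add: e_def nat_pow_mult)
    moreover have "t [^] j \<in> K #> (t [^] i)"
      using ij(2) t rcos_self[of "t [^] j" K] K.subgroup_axioms by simp
    then obtain k where "k \<in> K" "t [^] j = k \<otimes> t [^] i"
      by (auto simp: r_coset_def)
    ultimately have te: "t [^] e \<in> K"
      using t by (metis K.mem_carrier nat_pow_closed right_cancel)
    have iter: "t [^] i \<otimes> g \<otimes> inv (t [^] i) \<in> generate G S" for i :: nat
    proof (induction i)
      case (Suc i)
      have eq: "t [^] Suc i = t \<otimes> t [^] i"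
        using t nat_pow_Suc2 by blast
      have "t [^] Suc i \<otimes> g \<otimes> inv (t [^] Suc i) = t \<otimes> (t [^] i \<otimes> g \<otimes> inv (t [^] i)) \<otimes> inv t"
        unfolding eq using t Hc[OF g] by (simp add: inv_mult_group m_assoc)
      then show ?case using up[OF Suc] by simp
    qed (use g Hc[OF g] in simp)
    \<comment> \<open>Since \<open>e > 0\<close>, one factor \<open>t\<close> can be split off. The
      conjugate by the remaining power lies in H, so the full conjugate lies in t H t^-1 and
      therefore in \<open>K\<close>.\<close>
    obtain d where d: "e = Suc d" using ij by (cases e) (auto simp: e_def)
    have eq: "t [^] e = t \<otimes> t [^] d"
      using t nat_pow_Suc2 d by blast
    have "t [^] e \<otimes> g \<otimes> inv (t [^] e) = conj (t [^] d \<otimes> g \<otimes> inv (t [^] d))"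
      unfolding eq conj_def using t Hc[OF g] by (simp add: inv_mult_group m_assoc)
    with iter[of d] have "t [^] e \<otimes> g \<otimes> inv (t [^] e) \<in> K"
      using K(2) KK by blast
    with te have "inv (t [^] e) \<otimes> (t [^] e \<otimes> g \<otimes> inv (t [^] e)) \<otimes> t [^] e \<in> K"
      by blast
    also have "inv (t [^] e) \<otimes> (t [^] e \<otimes> g \<otimes> inv (t [^] e)) \<otimes> t [^] e = g"
      using t Hc[OF g] by (simp add: m_assoc inv_solve_left')
    finally show ?thesis .
  qed
  then have "g \<in> conj ` generate G S" using K(2) by blast
  then obtain h where h: "h \<in> generate G S" "g = t \<otimes> h \<otimes> inv t"
    by (auto simp: conj_def)
  then have "inv t \<otimes> g \<otimes> t = h"
    using t Hc[OF h(1)] by (simp add: m_assoc inv_solve_left')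
  with strict h show False by simp
qed

text \<open>A commutator: its height is zero for every grading, so inserting copies of it changes no
  exponent sum.\<close>

definition block :: "'x letter \<Rightarrow> 'x letter \<Rightarrow> 'x word" where
  "block y s = [y, s, inv_letter y, inv_letter s]"

text \<open>
  When \<open>weight c s > 0\<close>, the \<open>k\<close> commutators rise above the rest of the word, and the highest edges
  labelled \<open>x\<close> are crossed \<open>k\<close> times, always in the same direction.
\<close>

definition peak :: "nat \<Rightarrow> ('x \<Rightarrow> int) \<Rightarrow> 'x letter \<Rightarrow> 'x \<Rightarrow> 'x word \<Rightarrow> bool" where
  "peak k c s x w \<longleftrightarrow> (\<exists>A B y. w = A @ concat (replicate k (block y s)) @ B \<and> fst y = x \<and>
     0 \<le> weight c y \<and> heights c 0 (A @ B) \<subseteq> {..height c A} \<and> height c (A @ B) = 0)"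

lemma block_in_lists [simp]:
  "block y s \<in> lists (letters X) \<longleftrightarrow> y \<in> letters X \<and> s \<in> letters X"
  by (auto simp: block_def)

lemma height_block [simp]: "height c (block y s) = 0"
  by (simp add: block_def)

lemma height_blocks [simp]: "height c (concat (replicate k (block y s))) = 0"
  by (induction k) auto

lemma peak_height: "peak k c s x w \<Longrightarrow> height c w = 0"
  by (auto simp: peak_def)

section \<open>Recursion in decreasing height, and uniform bounds\<close>

lemma downward_recursion:
  fixes \<Psi> :: "('x \<Rightarrow> int \<Rightarrow> real) \<Rightarrow> 'x \<Rightarrow> int \<Rightarrow> real"
  assumes "\<And>f g x k. k < 0 \<Longrightarrow> (\<And>y j. j > k \<Longrightarrow> f y j = g y j) \<Longrightarrow> \<Psi> f x k = \<Psi> g x k"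
  shows "\<exists>f. \<forall>x k. f x k = (if k < 0 then \<Psi> f x k else b x k)"
proof -
  \<comment> \<open>Negative heights are ordered by their distance from 0; from 0 on, the values are
    prescribed by \<open>b\<close>.\<close>
  let ?R = "measure (\<lambda>(x::'x, k::int). nat (- k))"
  define F where "F f = (\<lambda>(x, k). if k < 0 then \<Psi> (\<lambda>x k. if k < 0 then f (x, k) else b x k) x k else b x k)"
    for f :: "'x \<times> int \<Rightarrow> real"
  have "adm_wf ?R F"
    unfolding adm_wf_def F_def by (auto intro!: assms)
  then have "wfrec ?R F = F (wfrec ?R F)"
    by (intro wfrec_fixpoint) auto
  then have eq: "wfrec ?R F (x, k) = F (wfrec ?R F) (x, k)" for x k by metis
  define f where "f x k = wfrec ?R F (x, k)" for x k
  have "(\<lambda>x k. if k < 0 then f x k else b x k) = f"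
    unfolding f_def by (intro ext, subst (2) eq) (simp add: F_def eq)
  then have "f x k = (if k < 0 then \<Psi> f x k else b x k)" for x k
    using eq[of x k] unfolding F_def f_def[symmetric] by (simp add: f_def[symmetric])
  then show ?thesis by blast
qed

lemma uniform_bound:
  fixes P :: "'a \<Rightarrow> int \<Rightarrow> bool"
  assumes "finite S" "\<And>x. x \<in> S \<Longrightarrow> \<exists>D. P x D" "\<And>x D E. P x D \<Longrightarrow> D \<le> E \<Longrightarrow> P x E"
  shows "\<exists>D\<ge>0. \<forall>x\<in>S. P x D"
  using assms(1,2)
proof (induction S)
  case (insert x S)
  then obtain D where "D \<ge> 0" "\<forall>x\<in>S. P x D" by auto
  moreover obtain E where "P x E" using insert.prems by blast
  ultimately
  have "\<forall>y\<in>insert x S. P y (max D E)" "max D E \<ge> 0"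
    using assms(3)[of _ D "max D E"] assms(3)[of _ E "max D E"] by auto
  then show ?case by blast
qed auto

text \<open>The bottom condition is the top condition for the reversed grading, in which
  \<open>(t, False)\<close> is the rising letter. Multiplicity 1 at the top lets a relator be solved
  for the commutator inside the group; multiplicity 2 at the bottom leaves room for the value 1/2,
  which is nonzero modulo the integers while its double is zero.\<close>

locale peaked_presentation =
  fixes X :: "'x set" and t :: 'x and c :: "'x \<Rightarrow> int" and r :: "'x \<Rightarrow> 'x word"
  assumes finite_X: "finite X" and t: "t \<in> X" "c t > 0" and X_neq: "X \<noteq> {t}"
    and r_closed: "\<And>x. x \<in> X - {t} \<Longrightarrow> r x \<in> carrier (free_group X)"
    and top: "\<And>x. x \<in> X - {t} \<Longrightarrow> peak 1 c (t, True) x (r x)"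
    and bottom: "\<And>x. x \<in> X - {t} \<Longrightarrow> peak 2 (\<lambda>x. - c x) (t, False) x (r x)"
begin

definition R where "R = r ` (X - {t})"

lemma R_closed: "R \<subseteq> carrier (free_group X)"
  using r_closed by (auto simp: R_def)

abbreviation "G \<equiv> presented_group X R"
abbreviation "ev \<equiv> word_class X R"

sublocale G: group G by (rule group_presented_group[OF R_closed])

lemmas ev_closed = word_class_closed[OF R_closed]
  and ev_append = word_class_append[OF R_closed]
  and ev_Nil = word_class_Nil[OF R_closed]
  and ev_winv = word_class_winv[OF R_closed]
  and ev_relator = word_class_relator[OF R_closed]

lemma ev_Cons: "a \<in> letters X \<Longrightarrow> w \<in> lists (letters X) \<Longrightarrow> ev (a # w) = ev [a] \<otimes>\<^bsub>G\<^esub> ev w"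
  using ev_append[of "[a]" w] by simp

lemma ev_inv_letter: "a \<in> letters X \<Longrightarrow> ev [inv_letter a] = inv\<^bsub>G\<^esub> ev [a]"
  using ev_winv[of "[a]"] by simp

lemma in_letters [simp]: "(x, b) \<in> letters X \<longleftrightarrow> x \<in> X"
  by (simp add: letters_def)

lemma letter_in_letters: "y \<in> letters X \<longleftrightarrow> fst y \<in> X"
  by (cases y) simp

text \<open>In each lift of \<open>r x\<close> the lowest \<open>x\<close>-edge is crossed twice in
  the same direction, and apart from \<open>t\<close>-edges, where \<open>f\<close> vanishes, all
  other edges are higher. So the value at a height below 0 is determined by values at greater
  heights, and the value 1/2 at height 0 enters only doubled.\<close>

lemma exists_cochain:
  obtains f where "\<And>k. f t k = 0" "\<And>x k. k > 0 \<Longrightarrow> f x k = 0" "\<And>x. x \<noteq> t \<Longrightarrow> f x 0 = 1 / 2"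
    "\<And>w h. w \<in> R \<Longrightarrow> pairing c f h w \<in> \<int>"
proof -
  have "\<exists>A B y. r x = A @ block y (t, False) @ block y (t, False) @ B \<and> fst y = x \<and>
      weight c y \<le> 0 \<and> heights c 0 (A @ B) \<subseteq> {height c A..}" if "x \<in> X - {t}" for x
    using bottom[OF that]
    by (fastforce simp: peak_def heights_uminus numeral_2_eq_2)
  then obtain A B y where AB: "\<And>x. x \<in> X - {t} \<Longrightarrow>
      r x = A x @ block (y x) (t, False) @ block (y x) (t, False) @ B x"
    and y: "\<And>x. x \<in> X - {t} \<Longrightarrow> fst (y x) = x"
      "\<And>x. x \<in> X - {t} \<Longrightarrow> weight c (y x) \<le> 0"
    and hts: "\<And>x. x \<in> X - {t} \<Longrightarrow> heights c 0 (A x @ B x) \<subseteq> {height c (A x)..}"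
    by metis
  \<comment> \<open>The height of the insertion point in the lift whose lowest \<open>x\<close>-edge
    has height \<open>k\<close>: the letters \<open>y x\<close> and \<open>(t, False)\<close> lead
    down from \<open>L x k\<close> to \<open>k\<close>.\<close>
  define L where "L x k = k - weight c (y x) + c t" for x k
  define rest where "rest f x h = pairing c f (h - height c (A x)) (A x) + pairing c f h (B x)"
    for f x h
  define sg :: "'x \<Rightarrow> real" where "sg x = (if snd (y x) then 1 else -1)" for x
  \<comment> \<open>The solution of the equation "the lift of \<open>r x\<close> integrates to 0"
    for the value on the lowest \<open>x\<close>-edge, whose coefficient is
    \<open>- 2 * sg x\<close>.\<close>
  define \<Psi> where "\<Psi> f x k = (if x \<in> X - {t} then f x (k + c t) + sg x / 2 * rest f x (L x k) else 0)"
    for f x k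
  define b :: "'x \<Rightarrow> int \<Rightarrow> real" where "b x k = (if k = 0 \<and> x \<noteq> t then 1 / 2 else 0)" for x k
  have hts': "heights c (h - height c (A x)) (A x) \<subseteq> {h..}" "heights c h (B x) \<subseteq> {h..}"
    if "x \<in> X - {t}" for x h
  proof -
    have "j - height c (A x) - h' \<ge> 0"
      if "j \<in> heights c h' (A x) \<or> j \<in> heights c (h' + height c (A x)) (B x)" for j h'
    proof -
      have "j - h' \<in> heights c 0 (A x @ B x)"
        using that heights_shift[of j c h' "A x @ B x"] by (auto simp: heights_append)
      then show ?thesis using hts[OF \<open>x \<in> X - {t}\<close>] by auto
    qed
    from this[of _ "h - height c (A x)"]
    show "heights c (h - height c (A x)) (A x) \<subseteq> {h..}" "heights c h (B x) \<subseteq> {h..}"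
      by (auto simp: algebra_simps)
  qed
  have rest_cong: "rest f x h = rest g x h"
    if "x \<in> X - {t}" "\<And>x k. k \<ge> h \<Longrightarrow> f x k = g x k" for f g x h
    unfolding rest_def using that hts'[OF that(1), of h] by (metis pairing_cong)
  have "\<exists>f. \<forall>x k. f x k = (if k < 0 then \<Psi> f x k else b x k)"
  proof (rule downward_recursion)
    fix f g :: "'x \<Rightarrow> int \<Rightarrow> real" and x k
    assume k: "k < (0::int)" and fg: "\<And>y j. j > k \<Longrightarrow> f y j = g y j"
    have "rest f x (L x k) = rest g x (L x k)" if "x \<in> X - {t}"
      using that y(2)[OF that] t by (intro rest_cong fg) (auto simp: L_def)
    moreover have "f x (k + c t) = g x (k + c t)"
      using t by (intro fg) simp
    ultimately show "\<Psi> f x k = \<Psi> g x k"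
      by (simp add: \<Psi>_def)
  qed
  then obtain f where f: "\<And>x k. f x k = (if k < 0 then \<Psi> f x k else b x k)" by blast
  have ft: "f t k = 0" for k
    by (subst f) (simp add: \<Psi>_def b_def)
  have f_pos: "f x k = 0" if "k > 0" for x k
    using that by (subst f) (simp add: b_def)
  have f_zero: "f x 0 = 1 / 2" if "x \<noteq> t" for x
    using that by (subst f) (simp add: b_def)
  have "pairing c f h (r x) \<in> \<int>" if x: "x \<in> X - {t}" for x h
  proof -
    define k where "k = h + height c (A x) + weight c (y x) - c t"
    have L: "L x k = h + height c (A x)" by (simp add: L_def k_def)
    have block: "pairing c f l (block (y x) (t, False)) =
        sg x * (f x (l + weight c (y x)) - f x (l + weight c (y x) - c t))" for l
      using y[OF x] by (auto simp: block_def ft sg_def min_def weight_def[of c "(t, False)"])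
    have eq: "pairing c f h (r x) = rest f x (L x k) + 2 * sg x * (f x (k + c t) - f x k)"
      unfolding AB[OF x] by (simp add: pairing_append block rest_def L) (simp add: k_def algebra_simps)
    have rest0: "rest f x (L x k) = 0" if "k \<ge> 0"
    proof -
      have "L x k > 0" using that y[OF x] t by (simp add: L_def)
      then have "rest f x (L x k) = rest (\<lambda>_ _. 0) x (L x k)"
        by (intro rest_cong[OF x] f_pos) simp
      then show ?thesis by (simp add: rest_def pairing_zero)
    qed
    \<comment> \<open>For \<open>k > 0\<close> every term vanishes. For \<open>k = 0\<close> all
      that survives is twice 1/2 up to sign. For \<open>k < 0\<close> the recursion makes the
      integral exactly 0.\<close>
    consider "k > 0" | "k = 0" | "k < 0" by linarith
    then show ?thesis
    proof cases
      case 1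
      then show ?thesis using t by (simp add: eq rest0 f_pos)
    next
      case 2
      then show ?thesis using t x rest0 by (simp add: eq f_pos f_zero sg_def)
    next
      case 3
      have "sg x * sg x = 1" by (simp add: sg_def)
      then have "pairing c f h (r x) = 0"
        using 3 x by (subst eq, subst (2) f) (simp add: \<Psi>_def algebra_simps)
      then show ?thesis by simp
    qed
  qed
  then show ?thesis using that[of f] ft f_pos f_zero by (auto simp: R_def)
qed

section \<open>Loops in a horizontal strip, and how to lower their top\<close>

definition loops :: "int \<Rightarrow> 'x word set" where
  "loops N = {w \<in> lists (letters X). heights c 0 w \<subseteq> {0..N} \<and> height c w = 0}"

text \<open>Solving the relator A [y, t] B for the commutator gives t y t^-1 y^-1 = B A. The closed
  path B A starts at the insertion point, a maximum of A B, and so never rises above its start.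
  Replacing t y t^-1 by u y avoids the \<open>y\<close>-edge that lies \<open>c t\<close>
  higher.\<close>

lemma push_loop:
  assumes x: "x \<in> X - {t}"
  obtains u y D where "u \<in> lists (letters X)" "fst y = x" "weight c y \<ge> 0" "height c u = 0"
    "\<And>p. heights c p u \<subseteq> {p - D..p}"
    "ev [(t, True)] \<otimes>\<^bsub>G\<^esub> ev [y] \<otimes>\<^bsub>G\<^esub> inv\<^bsub>G\<^esub> ev [(t, True)] = ev u \<otimes>\<^bsub>G\<^esub> ev [y]"
proof -
  obtain A B y where r: "r x = A @ block y (t, True) @ B" and y: "fst y = x" "0 \<le> weight c y"
    and hts: "heights c 0 (A @ B) \<subseteq> {..height c A}" and h0: "height c (A @ B) = 0"
    using top[OF x] by (auto simp: peak_def)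
  have "r x \<in> lists (letters X)" using r_closed[OF x] by (simp add: free_group_simps)
  then have AB: "A \<in> lists (letters X)" "B \<in> lists (letters X)" by (auto simp: r)
  have yX: "y \<in> letters X" using y x by (simp add: letter_in_letters)
  have hB: "height c B = - height c A" using h0 by simp
  have le: "j \<le> p" if "j \<in> heights c p (B @ A)" for j p
  proof -
    have "j \<in> heights c p B \<or> j \<in> heights c (p - height c A) A"
      using that by (auto simp: heights_append hB)
    then have "j \<in> heights c (p - height c A) (A @ B)"
      by (auto simp: heights_append)
    then have "j - (p - height c A) \<in> heights c 0 (A @ B)"
      using heights_shift by metis
    then show ?thesis using hts by auto
  qed
  define D where "D = - Min (heights c 0 (B @ A))"
  have ge: "j \<ge> p - D" if "j \<in> heights c p (B @ A)" for j p
  proof -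
    have "j - p \<in> heights c 0 (B @ A)" using that heights_shift by metis
    then have "Min (heights c 0 (B @ A)) \<le> j - p" by (intro Min_le) auto
    then show ?thesis by (simp add: D_def)
  qed
  define a b v s where "a = ev A" and "b = ev B" and "v = ev [y]" and "s = ev [(t, True)]"
  have cl: "a \<in> carrier G" "b \<in> carrier G" "v \<in> carrier G" "s \<in> carrier G"
    using AB yX t by (auto simp: a_def b_def v_def s_def intro!: ev_closed)
  have "ev (block y (t, True)) = v \<otimes>\<^bsub>G\<^esub> (s \<otimes>\<^bsub>G\<^esub> (inv\<^bsub>G\<^esub> v \<otimes>\<^bsub>G\<^esub> inv\<^bsub>G\<^esub> s))"
    using yX t cl unfolding block_def v_def s_def
    by (simp add: ev_Cons[of _ "_ # _"] ev_inv_letter)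
  moreover have "r x \<in> R" using x by (auto simp: R_def)
  then have "ev (A @ block y (t, True) @ B) = \<one>\<^bsub>G\<^esub>"
    using ev_relator[of "r x"] r by simp
  ultimately have "a \<otimes>\<^bsub>G\<^esub> (v \<otimes>\<^bsub>G\<^esub> (s \<otimes>\<^bsub>G\<^esub> (inv\<^bsub>G\<^esub> v \<otimes>\<^bsub>G\<^esub> inv\<^bsub>G\<^esub> s)) \<otimes>\<^bsub>G\<^esub> b) = \<one>\<^bsub>G\<^esub>"
    using AB yX t by (simp add: ev_append a_def b_def)
  then have "a \<otimes>\<^bsub>G\<^esub> (v \<otimes>\<^bsub>G\<^esub> s \<otimes>\<^bsub>G\<^esub> inv\<^bsub>G\<^esub> v \<otimes>\<^bsub>G\<^esub> inv\<^bsub>G\<^esub> s) = inv\<^bsub>G\<^esub> b"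
    using cl by (intro G.inv_equality[symmetric]) (auto simp: G.m_assoc)
  then have "v \<otimes>\<^bsub>G\<^esub> s \<otimes>\<^bsub>G\<^esub> inv\<^bsub>G\<^esub> v \<otimes>\<^bsub>G\<^esub> inv\<^bsub>G\<^esub> s = inv\<^bsub>G\<^esub> a \<otimes>\<^bsub>G\<^esub> inv\<^bsub>G\<^esub> b"
    using cl by (subst G.inv_solve_left) auto
  then have "inv\<^bsub>G\<^esub> (v \<otimes>\<^bsub>G\<^esub> s \<otimes>\<^bsub>G\<^esub> inv\<^bsub>G\<^esub> v \<otimes>\<^bsub>G\<^esub> inv\<^bsub>G\<^esub> s) = b \<otimes>\<^bsub>G\<^esub> a"
    using cl by (simp add: G.inv_mult_group)
  then have "s \<otimes>\<^bsub>G\<^esub> v \<otimes>\<^bsub>G\<^esub> inv\<^bsub>G\<^esub> s \<otimes>\<^bsub>G\<^esub> inv\<^bsub>G\<^esub> v = b \<otimes>\<^bsub>G\<^esub> a"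
    using cl by (simp add: G.inv_mult_group G.m_assoc)
  then have "s \<otimes>\<^bsub>G\<^esub> v \<otimes>\<^bsub>G\<^esub> inv\<^bsub>G\<^esub> s = b \<otimes>\<^bsub>G\<^esub> a \<otimes>\<^bsub>G\<^esub> v"
    using cl by (subst (asm) G.inv_solve_right') auto
  then show ?thesis
    using that[of "B @ A" y D] AB y hB le ge
    by (force simp: ev_append a_def b_def s_def v_def)
qed

text \<open>The result of \<open>push_loop\<close> in a form monotone in \<open>D\<close>, so that
  one bound serves all the finitely many generators.\<close>

definition bounded_push :: "'x \<Rightarrow> int \<Rightarrow> bool" where
  "bounded_push x D \<longleftrightarrow> (\<exists>u y. u \<in> lists (letters X) \<and> fst y = x \<and> 0 \<le> weight c y \<and> weight c y \<le> D \<and>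
     height c u = 0 \<and> (\<forall>p. heights c p u \<subseteq> {p - D..p}) \<and>
     ev [(t, True)] \<otimes>\<^bsub>G\<^esub> ev [y] \<otimes>\<^bsub>G\<^esub> inv\<^bsub>G\<^esub> ev [(t, True)] = ev u \<otimes>\<^bsub>G\<^esub> ev [y])"

lemma exists_bounded_push: "\<exists>D\<ge>0. \<forall>x\<in>X - {t}. bounded_push x D"
proof (rule uniform_bound)
  fix x assume "x \<in> X - {t}"
  then obtain u y D where *: "u \<in> lists (letters X)" "fst y = x" "weight c y \<ge> 0" "height c u = 0"
    "\<And>p. heights c p u \<subseteq> {p - D..p}"
    "ev [(t, True)] \<otimes>\<^bsub>G\<^esub> ev [y] \<otimes>\<^bsub>G\<^esub> inv\<^bsub>G\<^esub> ev [(t, True)] = ev u \<otimes>\<^bsub>G\<^esub> ev [y]"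
    by (rule push_loop) blast
  have "heights c p u \<subseteq> {p - max D (weight c y)..p}" for p
    by (rule order_trans[OF *(5)]) auto
  with * show "\<exists>D. bounded_push x D"
    unfolding bounded_push_def by (metis max.cobounded2)
next
  fix x D E assume *: "bounded_push x D" "D \<le> (E::int)"
  then obtain u y where u: "u \<in> lists (letters X)" "fst y = x" "0 \<le> weight c y" "weight c y \<le> D"
    "height c u = 0" "\<And>p. heights c p u \<subseteq> {p - D..p}"
    "ev [(t, True)] \<otimes>\<^bsub>G\<^esub> ev [y] \<otimes>\<^bsub>G\<^esub> inv\<^bsub>G\<^esub> ev [(t, True)] = ev u \<otimes>\<^bsub>G\<^esub> ev [y]"
    unfolding bounded_push_def by blast
  have "heights c p u \<subseteq> {p - E..p}" for p
    by (rule order_trans[OF u(6)]) (use *(2) in auto)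
  moreover have "weight c y \<le> E" using u(4) *(2) by simp
  ultimately show "bounded_push x E"
    unfolding bounded_push_def using u by blast
qed (use finite_X in simp)

text \<open>
  A vertex at the top height \<open>M\<close> is moved down along the edge \<open>t\<^sup>-\<^sup>1\<close>; the path class \<open>g\<close> from
  height \<open>h\<close> to height \<open>h'\<close> is then to be represented strictly below \<open>M\<close>.
\<close>

definition lowered :: "int \<Rightarrow> int \<Rightarrow> int" where
  "lowered M h = (if h = M then h - c t else h)"

definition descent :: "int \<Rightarrow> int \<Rightarrow> 'x word set" where
  "descent M h = (if h = M then ev [(t, True)] else \<one>\<^bsub>G\<^esub>)"

definition pushes :: "int \<Rightarrow> int \<Rightarrow> 'x word set \<Rightarrow> int \<Rightarrow> bool" where
  "pushes M h g h' \<longleftrightarrow> (\<exists>w\<in>lists (letters X). heights c (lowered M h) w \<subseteq> {0..M - 1} \<and>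
     lowered M h + height c w = lowered M h' \<and>
     ev w = descent M h \<otimes>\<^bsub>G\<^esub> g \<otimes>\<^bsub>G\<^esub> inv\<^bsub>G\<^esub> descent M h')"

lemma ev_t_closed [simp]: "ev [(t, b)] \<in> carrier G"
  using t by (intro ev_closed) simp

lemma descent_closed [simp]: "descent M h \<in> carrier G"
  by (simp add: descent_def)

lemma pushes_mult:
  assumes "pushes M h g h'" "pushes M h' g' h''" "g \<in> carrier G" "g' \<in> carrier G"
  shows "pushes M h (g \<otimes>\<^bsub>G\<^esub> g') h''"
proof -
  obtain w where w: "w \<in> lists (letters X)" "heights c (lowered M h) w \<subseteq> {0..M - 1}"
      "lowered M h + height c w = lowered M h'"
      "ev w = descent M h \<otimes>\<^bsub>G\<^esub> g \<otimes>\<^bsub>G\<^esub> inv\<^bsub>G\<^esub> descent M h'"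
    using assms by (auto simp: pushes_def)
  obtain w' where w': "w' \<in> lists (letters X)" "heights c (lowered M h') w' \<subseteq> {0..M - 1}"
      "lowered M h' + height c w' = lowered M h''"
      "ev w' = descent M h' \<otimes>\<^bsub>G\<^esub> g' \<otimes>\<^bsub>G\<^esub> inv\<^bsub>G\<^esub> descent M h''"
    using assms by (auto simp: pushes_def)
  have "inv\<^bsub>G\<^esub> descent M h' \<otimes>\<^bsub>G\<^esub> (descent M h' \<otimes>\<^bsub>G\<^esub> x) = x" if "x \<in> carrier G" for x
    using that by (simp add: G.m_assoc[symmetric])
  then have "ev (w @ w') = descent M h \<otimes>\<^bsub>G\<^esub> (g \<otimes>\<^bsub>G\<^esub> g') \<otimes>\<^bsub>G\<^esub> inv\<^bsub>G\<^esub> descent M h''"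
    using w w' assms by (simp add: ev_append G.m_assoc)
  with w w' show ?thesis
    unfolding pushes_def by (intro bexI[of _ "w @ w'"]) (auto simp: heights_append)
qed

lemma pushes_inv:
  assumes "pushes M h g h'" "g \<in> carrier G"
  shows "pushes M h' (inv\<^bsub>G\<^esub> g) h"
proof -
  obtain w where w: "w \<in> lists (letters X)" "heights c (lowered M h) w \<subseteq> {0..M - 1}"
      "lowered M h + height c w = lowered M h'"
      "ev w = descent M h \<otimes>\<^bsub>G\<^esub> g \<otimes>\<^bsub>G\<^esub> inv\<^bsub>G\<^esub> descent M h'"
    using assms by (auto simp: pushes_def)
  have "ev (winv w) = descent M h' \<otimes>\<^bsub>G\<^esub> inv\<^bsub>G\<^esub> g \<otimes>\<^bsub>G\<^esub> inv\<^bsub>G\<^esub> descent M h"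
    using w assms by (simp add: ev_winv G.inv_mult_group G.m_assoc)
  moreover have "heights c (lowered M h') (winv w) \<subseteq> {0..M - 1}"
    using w heights_winv[of c "lowered M h" w] by simp
  ultimately show ?thesis
    using w unfolding pushes_def by (intro bexI[of _ "winv w"]) auto
qed

text \<open>A \<open>t\<close>-edge that ends at the top is the very edge along which its endpoint
  moves down; what remains of it is the empty path.\<close>

lemma pushes_t:
  assumes "{h, h + c t} \<subseteq> {0..M}"
  shows "pushes M h (ev [(t, True)]) (h + c t)"
proof -
  let ?w = "if h + c t = M then [] else [(t, True)]"
  have w: "weight c (t, True) = c t" by (simp add: weight_def)
  show ?thesis
    unfolding pushes_def
    using assms t by (intro bexI[of _ ?w]) (auto simp: lowered_def descent_def w ev_Nil)
qed

text \<open>An edge that does not touch the top stays. A horizontal edge at the top becomes u y, an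
  edge rising to the top becomes t^-1 u y. The bound on \<open>M\<close> leaves room for the edge
  itself (\<open>D\<close>), the descent (\<open>c t\<close>) and the depth of \<open>u\<close>
  (\<open>D\<close>), so no height becomes negative.\<close>

lemma pushes_letter:
  assumes x: "x \<in> X - {t}" "bounded_push x D" and M: "2 * D + c t < M"
  obtains y where "fst y = x" "\<And>h. {h, h + weight c y} \<subseteq> {0..M} \<Longrightarrow> pushes M h (ev [y]) (h + weight c y)"
proof -
  obtain u y where u: "u \<in> lists (letters X)" and y: "fst y = x" "0 \<le> weight c y" "weight c y \<le> D"
    and hu: "height c u = 0" "\<And>p. heights c p u \<subseteq> {p - D..p}"
    and eq: "ev [(t, True)] \<otimes>\<^bsub>G\<^esub> ev [y] \<otimes>\<^bsub>G\<^esub> inv\<^bsub>G\<^esub> ev [(t, True)] = ev u \<otimes>\<^bsub>G\<^esub> ev [y]"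
    using x(2) unfolding bounded_push_def by blast
  have yX: "y \<in> letters X" using y x by (simp add: letter_in_letters)
  have cl: "ev u \<in> carrier G" "ev [y] \<in> carrier G"
    using u yX by (auto intro!: ev_closed)
  have "pushes M h (ev [y]) (h + weight c y)" if h: "{h, h + weight c y} \<subseteq> {0..M}" for h
  proof -
    consider "h + weight c y \<noteq> M" | "h = M" "weight c y = 0" | "h \<noteq> M" "h + weight c y = M"
      by linarith
    then show ?thesis
    proof cases
      case 1
      then show ?thesis
        using h y yX cl unfolding pushes_def
        by (intro bexI[of _ "[y]"]) (auto simp: lowered_def descent_def)
    next
      case 2
      then show ?thesis
        using h y yX cl u hu(1) hu(2)[of "M - c t"] M t unfolding pushes_def
        by (intro bexI[of _ "u @ [y]"])
          (auto simp: lowered_def descent_def eq ev_append heights_append)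
    next
      case 3
      let ?w = "(t, False) # u @ [y]"
      have w: "weight c (t, False) = - c t" by (simp add: weight_def)
      have "ev ?w = inv\<^bsub>G\<^esub> ev [(t, True)] \<otimes>\<^bsub>G\<^esub> (ev u \<otimes>\<^bsub>G\<^esub> ev [y])"
        using u yX t ev_inv_letter[of "(t, True)"]
        by (simp add: ev_Cons[of _ "_ @ _"] ev_append inv_letter_def)
      also have "\<dots> = ev [y] \<otimes>\<^bsub>G\<^esub> inv\<^bsub>G\<^esub> ev [(t, True)]"
        using cl unfolding eq[symmetric] by (simp add: G.m_assoc G.inv_solve_left')
      finally show ?thesis
        using 3 h y yX cl u hu(1) hu(2)[of "h - c t"] M t unfolding pushes_def
        by (intro bexI[of _ ?w])
          (auto simp: lowered_def descent_def heights_append w)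
    qed
  qed
  with y show ?thesis using that by blast
qed

lemma pushes_word:
  assumes D: "\<forall>x\<in>X - {t}. bounded_push x D" and M: "2 * D + c t < M" "0 \<le> D"
    and w: "w \<in> lists (letters X)" "heights c h w \<subseteq> {0..M}"
  shows "pushes M h (ev w) (h + height c w)"
  using w
proof (induction w arbitrary: h)
  case Nil
  then show ?case
    using M t unfolding pushes_def
    by (intro bexI[of _ "[]"]) (auto simp: lowered_def descent_def ev_Nil)
next
  case (Cons z w)
  then have zw: "z \<in> letters X" "w \<in> lists (letters X)" by auto
  have cl: "ev [a] \<in> carrier G" if "a \<in> letters X" for a
    using that by (intro ev_closed) auto
  have h: "{h, h + weight c z} \<subseteq> {0..M}"
    using Cons.prems subsetD[OF _ start_in_heights[of "h + weight c z" c w], of "{0..M}"] by auto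
  obtain y where y: "fst y = fst z"
    "\<And>h. {h, h + weight c y} \<subseteq> {0..M} \<Longrightarrow> pushes M h (ev [y]) (h + weight c y)"
  proof (cases "fst z = t")
    case True
    then show ?thesis
      using that[of "(t, True)"] pushes_t by (simp add: weight_def)
  next
    case False
    then have "fst z \<in> X - {t}" using zw by (simp add: letter_in_letters)
    then show ?thesis using pushes_letter[of "fst z" D M] D M that by auto
  qed
  have yX: "y \<in> letters X" using y(1) zw(1) by (simp add: letter_in_letters)
  \<comment> \<open>Only one orientation of each edge has been treated; the other follows by
    reversing the path.\<close>
  have "z = y \<or> z = inv_letter y"
    using y(1) by (cases y, cases z) (auto simp: inv_letter_def)
  then have "pushes M h (ev [z]) (h + weight c z)"
  proof
    assume z: "z = inv_letter y"
    then have "pushes M (h + weight c z) (ev [y]) h"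
      using y(2)[of "h + weight c z"] h by simp
    from pushes_inv[OF this cl[OF yX]] show ?thesis
      using yX by (simp add: z ev_inv_letter)
  qed (use y(2) h in simp)
  moreover have "pushes M (h + weight c z) (ev w) (h + weight c z + height c w)"
    using Cons by (intro Cons.IH) auto
  ultimately show ?case
    using pushes_mult[of M h "ev [z]" _ "ev w"] cl[OF zw(1)] ev_closed[OF zw(2)] zw
    by (simp add: ev_Cons[of z w] add.assoc)
qed

text \<open>Repeated pushing lowers the top of a loop by one unit at a time until it is
  \<open>N\<close>. The first bound makes the strip high enough for the commutator of any generator
  with \<open>t\<close>.\<close>

lemma lower_loops:
  obtains N where "\<And>x. x \<in> X \<Longrightarrow> \<bar>c x\<bar> + c t \<le> N" "0 \<le> N"
    "\<And>M w. w \<in> loops M \<Longrightarrow> \<exists>w'\<in>loops N. ev w' = ev w"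
proof -
  obtain D where D: "D \<ge> 0" "\<forall>x\<in>X - {t}. bounded_push x D"
    using exists_bounded_push by blast
  \<comment> \<open>Every \<open>M > N\<close> satisfies \<open>2 * D + c t < M\<close>, as pushing
    requires; the second \<open>c t\<close> accommodates the commutators, whose height is at most
    \<open>max D (c t) + c t\<close>.\<close>
  define N where "N = 2 * D + 2 * c t"
  have "\<bar>c x\<bar> \<le> max D (c t)" if "x \<in> X" for x
  proof (cases "x = t")
    case False
    then have "bounded_push x D" using D(2) that by blast
    then obtain y where "fst y = x" "0 \<le> weight c y" "weight c y \<le> D"
      unfolding bounded_push_def by blast
    then show ?thesis by (auto simp: weight_def split: if_splits)
  qed (use t in simp)
  then have "\<bar>c x\<bar> + c t \<le> N" if "x \<in> X" for x
    using that D(1) t by (fastforce simp: N_def)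
  moreover have "\<exists>w'\<in>loops N. ev w' = ev w" if "w \<in> loops (N + int k)" for w k
    using that
  proof (induction k arbitrary: w)
    case (Suc k)
    define M where "M = N + int (Suc k)"
    \<comment> \<open>\<open>M \<noteq> 0\<close> keeps the base point 0 away from the top, so that
      the loop is not conjugated when it is pushed.\<close>
    have M: "2 * D + c t < M" "M \<noteq> 0" using D(1) t by (auto simp: M_def N_def)
    have w: "w \<in> lists (letters X)" "heights c 0 w \<subseteq> {0..M}" "height c w = 0"
      using Suc.prems by (auto simp: loops_def M_def)
    have "pushes M 0 (ev w) 0"
      using pushes_word[OF D(2) M(1) D(1) w(1,2)] w(3) by simp
    then obtain w' where "w' \<in> loops (N + int k)" "ev w' = ev w"
      using M ev_closed[OF w(1)] unfolding pushes_def loops_def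
      by (auto simp: lowered_def descent_def M_def)
    then show ?case using Suc.IH by metis
  qed auto
  moreover have "loops M \<subseteq> loops (N + int (nat (M - N)))" for M
    by (auto simp: loops_def)
  ultimately have "\<exists>w'\<in>loops N. ev w' = ev w" if "w \<in> loops M" for M w
    using that by blast
  moreover have "0 \<le> N" using D(1) t by (simp add: N_def)
  ultimately show ?thesis
    using \<open>\<And>x. x \<in> X \<Longrightarrow> \<bar>c x\<bar> + c t \<le> N\<close> that[of N] by blast
qed

text \<open>These are the usual generators of the fundamental group of a finite graph: a path from 0
  is chosen to each vertex reachable inside the strip, every edge is completed to a loop by the
  chosen paths, and a loop is the product of the loops of its edges.\<close>

lemma loops_generated:
  assumes "0 \<le> N"
  obtains S where "finite S" "S \<subseteq> carrier G" "generate G S = ev ` loops N"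
proof -
  define paths where "paths h = {w \<in> lists (letters X). heights c 0 w \<subseteq> {0..N} \<and> height c w = h}" for h
  \<comment> \<open>The path to 0 is chosen empty, so that the product for a loop is the loop itself
    and not a conjugate.\<close>
  define p where "p h = (if h = 0 then [] else (SOME w. w \<in> paths h))" for h
  define E where "E = {(h, z). h \<in> {0..N} \<and> z \<in> letters X \<and> paths h \<noteq> {} \<and> paths (h + weight c z) \<noteq> {}}"
  define S where "S = (\<lambda>(h, z). ev (p h @ [z] @ winv (p (h + weight c z)))) ` E"
  have paths_0: "paths 0 = loops N" by (auto simp: paths_def loops_def)
  have p: "p h \<in> paths h" if "paths h \<noteq> {}" for h
  proof (cases "h = 0")
    case True
    then show ?thesis using assms by (auto simp: p_def paths_def)
  next
    case False
    then show ?thesis using that some_in_eq[of "paths h"] by (simp add: p_def)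
  qed
  have S_loops: "S \<subseteq> ev ` loops N"
  proof -
    have "p h @ [z] @ winv (p (h + weight c z)) \<in> loops N" if "(h, z) \<in> E" for h z
    proof -
      let ?k = "h + weight c z"
      have z: "z \<in> letters X" and ph: "p h \<in> paths h" and pk: "p ?k \<in> paths ?k"
        using that p by (auto simp: E_def)
      have "heights c ?k (winv (p ?k)) \<subseteq> {0..N}"
        using heights_winv[of c 0 "p ?k"] pk by (simp add: paths_def)
      then show ?thesis
        using z ph pk subsetD[OF _ end_in_heights[of 0 c "p h"], of "{0..N}"]
        by (auto simp: loops_def paths_def heights_append)
    qed
    then show ?thesis by (auto simp: S_def)
  qed
  have loops_carrier: "ev ` loops N \<subseteq> carrier G"
    using ev_closed by (auto simp: loops_def)
  have "finite S"
  proof -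
    have "E \<subseteq> {0..N} \<times> letters X" by (auto simp: E_def)
    then show ?thesis
      using finite_X finite_subset by (fastforce simp: S_def letters_def)
  qed
  moreover have S_carrier: "S \<subseteq> carrier G" using S_loops loops_carrier by blast
  moreover have "generate G S \<subseteq> ev ` loops N"
  proof (rule G.generate_subgroup_incl[OF S_loops G.subgroupI[OF loops_carrier]])
    show "ev ` loops N \<noteq> {}" using assms by (auto simp: loops_def intro!: exI[of _ "[]"])
  next
    fix g assume "g \<in> ev ` loops N"
    then obtain w where w: "w \<in> loops N" "g = ev w" by auto
    then have "winv w \<in> loops N" using heights_winv[of c 0 w] by (auto simp: loops_def)
    moreover have "inv\<^bsub>G\<^esub> g = ev (winv w)" using w by (auto simp: loops_def ev_winv)
    ultimately show "inv\<^bsub>G\<^esub> g \<in> ev ` loops N" by blast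
  next
    fix g g' assume "g \<in> ev ` loops N" "g' \<in> ev ` loops N"
    then obtain w w' where w: "w \<in> loops N" "g = ev w" "w' \<in> loops N" "g' = ev w'" by auto
    then have "w @ w' \<in> loops N" by (auto simp: loops_def heights_append)
    moreover have "g \<otimes>\<^bsub>G\<^esub> g' = ev (w @ w')" using w by (auto simp: loops_def ev_append)
    ultimately show "g \<otimes>\<^bsub>G\<^esub> g' \<in> ev ` loops N" by blast
  qed
  moreover have "ev ` loops N \<subseteq> generate G S"
  proof -
    have "ev (p h @ w @ winv (p (h + height c w))) \<in> generate G S"
      if "w \<in> lists (letters X)" "paths h \<noteq> {}" "heights c h w \<subseteq> {0..N}" for w h
      using that
    proof (induction w arbitrary: h rule: list.induct)
      case Nil
      then have "p h \<in> lists (letters X)" using p by (auto simp: paths_def)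
      then have "ev (p h @ winv (p h)) = \<one>\<^bsub>G\<^esub>"
        using ev_closed[of "p h"] by (simp add: ev_append ev_winv)
      then show ?case by (simp add: generate.one)
    next
      case (Cons z w)
      let ?k = "h + weight c z"
      have z: "z \<in> letters X" "w \<in> lists (letters X)"
        using Cons.prems(1) by simp_all
      have h: "h \<in> {0..N}" "?k \<in> {0..N}"
        using Cons.prems(3) subsetD[OF _ start_in_heights[of "?k" c w], of "{0..N}"] by auto
      have "p h \<in> paths h" using p Cons.prems by blast
      then have "p h @ [z] \<in> paths ?k"
        using z h by (auto simp: paths_def heights_append)
      then have ne: "paths ?k \<noteq> {}" by blast
      have pk: "p ?k \<in> lists (letters X)" "p h \<in> lists (letters X)"
        "p (?k + height c w) \<in> lists (letters X)"
      proof -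
        show "p ?k \<in> lists (letters X)" "p h \<in> lists (letters X)"
          using p ne Cons.prems by (auto simp: paths_def)
        have "p ?k @ w \<in> paths (?k + height c w)"
          using p[OF ne] Cons.prems by (auto simp: paths_def heights_append)
        then have "p (?k + height c w) \<in> paths (?k + height c w)" using p by blast
        then show "p (?k + height c w) \<in> lists (letters X)" by (simp add: paths_def)
      qed
      have 1: "ev (p ?k @ w @ winv (p (?k + height c w))) \<in> generate G S"
        using Cons.prems z ne by (intro Cons.IH) auto
      have 2: "ev (p h @ [z] @ winv (p ?k)) \<in> generate G S"
        using Cons.prems z h ne by (intro generate.incl) (auto simp: S_def E_def)
      have "ev (p h @ [z] @ winv (p ?k)) \<otimes>\<^bsub>G\<^esub> ev (p ?k @ w @ winv (p (?k + height c w))) =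
          ev (p h) \<otimes>\<^bsub>G\<^esub> (ev [z] \<otimes>\<^bsub>G\<^esub> (inv\<^bsub>G\<^esub> ev (p ?k) \<otimes>\<^bsub>G\<^esub>
           (ev (p ?k) \<otimes>\<^bsub>G\<^esub> (ev w \<otimes>\<^bsub>G\<^esub> inv\<^bsub>G\<^esub> ev (p (?k + height c w))))))"
        using pk z ev_closed by (simp add: ev_append ev_Cons[of z "_ @ _"] ev_Cons[of z "winv _"] ev_winv G.m_assoc)
      also have "\<dots> = ev (p h) \<otimes>\<^bsub>G\<^esub> (ev [z] \<otimes>\<^bsub>G\<^esub> (ev w \<otimes>\<^bsub>G\<^esub> inv\<^bsub>G\<^esub> ev (p (?k + height c w))))"
        using pk z ev_closed by (simp add: G.m_assoc[symmetric])
      also have "\<dots> = ev (p h @ (z # w) @ winv (p (?k + height c w)))"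
        using pk z ev_closed by (simp add: ev_append ev_Cons[of z "_ @ _"] ev_winv)
      finally show ?case
        using generate.eng[OF 2 1] by (simp add: add.assoc)
    qed
    then have main: "ev (p 0 @ w @ winv (p (0 + height c w))) \<in> generate G S" if "w \<in> loops N" for w
      using that paths_0 unfolding loops_def by blast
    have "ev w \<in> generate G S" if "w \<in> loops N" for w
      using main[OF that] that by (simp add: p_def loops_def)
    then show ?thesis by blast
  qed
  ultimately show ?thesis using that[of S] by blast
qed

text \<open>Conjugation by \<open>t\<close> carries loops into the strip
  \<open>{0..N + c t}\<close>, from where they are lowered again. That the inclusion is strict is
  detected by the cochain on a commutator based at height 0.\<close>

theorem not_subgroup_separable: "\<not> subgroup_separable G"
proof -
  obtain N where N: "\<And>x. x \<in> X \<Longrightarrow> \<bar>c x\<bar> + c t \<le> N" "0 \<le> N"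
    "\<And>M w. w \<in> loops M \<Longrightarrow> \<exists>w'\<in>loops N. ev w' = ev w"
    using lower_loops by blast
  obtain S where S: "finite S" "S \<subseteq> carrier G" "generate G S = ev ` loops N"
    using loops_generated[OF N(2)] by blast
  obtain f where f: "\<And>k. f t k = 0" "\<And>x k. k > 0 \<Longrightarrow> f x k = 0" "\<And>x. x \<noteq> t \<Longrightarrow> f x 0 = 1 / 2"
    "\<And>w h. w \<in> R \<Longrightarrow> pairing c f h w \<in> \<int>"
    using exists_cochain by blast
  obtain x where x: "x \<in> X" "x \<noteq> t" using X_neq t by blast
  define y where "y = (x, c x \<ge> 0)"
  define g where "g = block y (t, True)"
  have y: "y \<in> letters X" "weight c y = \<bar>c x\<bar>" "fst y = x"
    using x by (auto simp: y_def weight_def)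
  have w: "weight c (t, b) = (if b then c t else - c t)" for b
    by (simp add: weight_def)
  have g_loop: "g \<in> loops N"
    using y N(1)[OF x(1)] t unfolding loops_def g_def by (auto simp: block_def w)
  \<comment> \<open>One \<open>x\<close>-edge of \<open>g\<close> has height 0 and value 1/2, the
    other has height \<open>c t\<close> and value 0, and \<open>f\<close> vanishes on
    \<open>t\<close>-edges.\<close>
  have "pairing c f 0 g = 1 / 2 \<or> pairing c f 0 g = - 1 / 2"
    using y t x f by (auto simp: g_def block_def w min_def)
  moreover have half: "(1 / 2 :: real) \<notin> \<int>"
  proof
    assume "(1 / 2 :: real) \<in> \<int>"
    then obtain k :: int where "1 / 2 = real_of_int k" by (auto elim: Ints_cases)
    then have "real_of_int (2 * k) = real_of_int 1" by simp
    then show False unfolding of_int_eq_iff by presburger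
  qed
  ultimately have g_pairing: "pairing c f 0 g \<notin> \<int>"
    using Ints_minus[of "pairing c f 0 g"] by (metis minus_divide_left minus_minus)
  show ?thesis
  proof (rule G.not_subgroup_separable_ascending[OF S(1,2)])
    show "ev [(t, True)] \<in> carrier G" by simp
  next
    fix h assume "h \<in> generate G S"
    then obtain w where w': "w \<in> loops N" "h = ev w" using S(3) by auto
    let ?w = "[(t, True)] @ w @ winv [(t, True)]"
    have wl: "w \<in> lists (letters X)" using w' by (simp add: loops_def)
    have "heights c (c t) w \<subseteq> {0..N + c t}"
      using heights_shift[of _ c "c t" w] w' t by (fastforce simp: loops_def)
    then have "?w \<in> loops (N + c t)"
      using w' t N(2) by (auto simp: loops_def heights_append w)
    then obtain w'' where "w'' \<in> loops N" "ev w'' = ev ?w" using N(3) by blast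
    then have "ev ?w \<in> ev ` loops N" by (metis imageI)
    moreover have "ev ?w = ev [(t, True)] \<otimes>\<^bsub>G\<^esub> h \<otimes>\<^bsub>G\<^esub> inv\<^bsub>G\<^esub> ev [(t, True)]"
      using wl t ev_closed[OF wl] ev_winv[of "[(t, True)]"] unfolding w'(2)
      by (subst ev_append, simp, simp, subst ev_append) (simp_all add: G.m_assoc)
    ultimately show "ev [(t, True)] \<otimes>\<^bsub>G\<^esub> h \<otimes>\<^bsub>G\<^esub> inv\<^bsub>G\<^esub> ev [(t, True)] \<in> generate G S"
      using S(3) by simp
  next
    show "ev g \<in> generate G S" using g_loop S(3) by blast
    show "inv\<^bsub>G\<^esub> ev [(t, True)] \<otimes>\<^bsub>G\<^esub> ev g \<otimes>\<^bsub>G\<^esub> ev [(t, True)] \<notin> generate G S"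
    proof
      assume "inv\<^bsub>G\<^esub> ev [(t, True)] \<otimes>\<^bsub>G\<^esub> ev g \<otimes>\<^bsub>G\<^esub> ev [(t, True)] \<in> generate G S"
      then obtain w where w': "w \<in> loops N"
        "inv\<^bsub>G\<^esub> ev [(t, True)] \<otimes>\<^bsub>G\<^esub> ev g \<otimes>\<^bsub>G\<^esub> ev [(t, True)] = ev w"
        using S(3) by auto
      have wl: "w \<in> lists (letters X)" "height c w = 0" "g \<in> lists (letters X)" "height c g = 0"
        using w' g_loop by (auto simp: loops_def)
      \<comment> \<open>This word represents g^-1 t w t^-1, which the assumption makes trivial. Here
        \<open>w\<close> runs at heights from \<open>c t\<close> on, where \<open>f\<close>
        vanishes, so \<open>winv g\<close> alone contributes and the integral is not an
        integer.\<close>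
      let ?u = "winv g @ [(t, True)] @ w @ [(t, False)]"
      have cl: "ev g \<in> carrier G" "ev [(t, True)] \<in> carrier G" "ev w \<in> carrier G"
        using wl ev_closed by auto
      have "ev ?u = inv\<^bsub>G\<^esub> ev g \<otimes>\<^bsub>G\<^esub> (ev [(t, True)] \<otimes>\<^bsub>G\<^esub> (ev w \<otimes>\<^bsub>G\<^esub> inv\<^bsub>G\<^esub> ev [(t, True)]))"
        using wl t ev_inv_letter[of "(t, True)"]
        by (simp add: ev_append ev_winv ev_Cons[of _ "_ @ _"] inv_letter_def)
      also have "\<dots> = \<one>\<^bsub>G\<^esub>"
        using cl unfolding w'(2)[symmetric]
        by (simp add: G.m_assoc) (simp add: G.m_assoc[symmetric])
      finally have "ev ?u = \<one>\<^bsub>G\<^esub>" .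
      moreover have "height c v = 0" if "v \<in> R" for v
        using that peak_height[OF top] by (auto simp: R_def)
      moreover have "?u \<in> lists (letters X)" using wl t by simp
      ultimately have "pairing c f 0 ?u \<in> \<int>"
        using f(4) pairing_in_Ints_if_trivial[OF R_closed] by blast
      moreover have "pairing c f 0 (winv g) = - pairing c f 0 g"
        using pairing_winv[of c f 0 g] wl by simp
      moreover have "pairing c f (c t) w = 0"
      proof -
        have "heights c (c t) w \<subseteq> {1..}"
          using heights_shift[of _ c "c t" w] w' t by (fastforce simp: loops_def)
        then have "pairing c f (c t) w = pairing c (\<lambda>_ _. 0) (c t) w"
          using f(2) by (intro pairing_cong[of c "c t" w 1]) auto
        then show ?thesis by (simp add: pairing_zero)
      qed
      ultimately have "- pairing c f 0 g \<in> \<int>"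
        using wl f(1) by (simp add: pairing_append w)
      then show False using g_pairing by simp
    qed
  qed
qed

end

section \<open>Inserting extrema into relators\<close>

text \<open>Taking the first maximum makes the preceding letter strictly rising and lets the
  position be recovered after the insertion.\<close>

definition peak_pos :: "('x \<Rightarrow> int) \<Rightarrow> 'x word \<Rightarrow> nat" where
  "peak_pos c w = (LEAST p. \<forall>j. height c (take j w) \<le> height c (take p w))"

text \<open>An orientation of \<open>x\<close> of nonnegative weight. For weight zero both qualify;
  copying the sign of the last letter then prevents a cyclic cancellation when the insertion is at
  the very beginning.\<close>

definition side :: "('x \<Rightarrow> int) \<Rightarrow> 'x \<Rightarrow> 'x word \<Rightarrow> 'x letter" where
  "side c x w = (x, if c x = 0 then snd (last w) else 0 < c x)"

definition add_peak :: "nat \<Rightarrow> ('x \<Rightarrow> int) \<Rightarrow> 'x letter \<Rightarrow> 'x \<Rightarrow> 'x word \<Rightarrow> 'x word" where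
  "add_peak k c s x w =
     take (peak_pos c w) w @ concat (replicate k (block (side c x w) s)) @ drop (peak_pos c w) w"

lemma heights_eq_image: "heights c h w = range (\<lambda>j. h + height c (take j w))"
proof (induction w arbitrary: h)
  case (Cons a w)
  have "range f = insert (f 0) (range (\<lambda>j. f (Suc j)))" for f :: "nat \<Rightarrow> int"
    by (subst UNIV_nat_eq) (simp add: image_image)
  from this[of "\<lambda>j. h + height c (take j (a # w))"] show ?case
    by (simp add: Cons add.assoc)
qed auto

lemma peak_pos:
  shows peak_pos_max: "height c (take j w) \<le> height c (take (peak_pos c w) w)"
    and peak_pos_first: "j < peak_pos c w \<Longrightarrow> height c (take j w) < height c (take (peak_pos c w) w)"
proof -
  have "heights c 0 w \<noteq> {}" using start_in_heights by blast
  then have "Max (heights c 0 w) \<in> heights c 0 w"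
    by (intro Max_in) auto
  then obtain p where p: "Max (heights c 0 w) = height c (take p w)"
    by (auto simp: heights_eq_image)
  have "height c (take j w) \<le> height c (take p w)" for j
  proof -
    have "height c (take j w) \<in> heights c 0 w" by (simp add: heights_eq_image)
    then show ?thesis unfolding p[symmetric] by (intro Max_ge) simp_all
  qed
  then have max: "\<forall>j. height c (take j w) \<le> height c (take (peak_pos c w) w)"
    unfolding peak_pos_def by (intro LeastI) blast
  then show "height c (take j w) \<le> height c (take (peak_pos c w) w)" by blast
  assume "j < peak_pos c w"
  then have "\<not> (\<forall>i. height c (take i w) \<le> height c (take j w))"
    unfolding peak_pos_def by (rule not_less_Least)
  then show "height c (take j w) < height c (take (peak_pos c w) w)"
    using max by (meson le_less_trans not_le)
qed

lemma peak_pos_eqI: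
  assumes "\<And>j. height c (take j w) \<le> height c (take p w)"
    and "\<And>j. j < p \<Longrightarrow> height c (take j w) < height c (take p w)"
  shows "peak_pos c w = p"
  unfolding peak_pos_def using assms by (intro Least_equality) (auto simp: not_less[symmetric])

lemma peak_pos_less_length:
  assumes "w \<noteq> []" "height c w = 0"
  shows "peak_pos c w < length w"
proof (rule ccontr)
  assume "\<not> ?thesis"
  moreover from this have "0 < peak_pos c w" using assms(1) by (cases w) auto
  ultimately show False using peak_pos_first[of 0 c w] assms(2) by simp
qed

lemma heights_insert:
  "height c D = 0 \<Longrightarrow>
    heights c h (U @ D @ V) = heights c h (U @ V) \<union> heights c (h + height c U) D"
  by (auto simp: heights_append)

lemma length_blocks [simp]: "length (concat (replicate k (block y s))) = 4 * k"
  by (induction k) (auto simp: block_def)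

lemma blocks_in_lists:
  "{y, s} \<subseteq> letters X \<Longrightarrow> concat (replicate k (block y s)) \<in> lists (letters X)"
  by (induction k) (auto simp: block_def)

lemma heights_blocks_le:
  assumes "0 \<le> weight c y" "0 \<le> weight c s"
  shows "heights c h (concat (replicate k (block y s))) \<subseteq> {h..h + weight c y + weight c s}"
  using assms by (induction k arbitrary: h) (auto simp: heights_append, auto simp: block_def)

lemma reduced_append:
  "reduced (u @ v) \<longleftrightarrow> reduced u \<and> reduced v \<and> (u \<noteq> [] \<longrightarrow> v \<noteq> [] \<longrightarrow> hd v \<noteq> inv_letter (last u))"
  by (auto simp: reduced_def successively_append_iff)

lemma blocks:
  assumes "fst s \<noteq> fst y" "k > 0"
  shows "concat (replicate k (block y s)) \<noteq> []" "hd (concat (replicate k (block y s))) = y"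
    "last (concat (replicate k (block y s))) = inv_letter s"
    "reduced (concat (replicate k (block y s)))"
proof -
  have "concat (replicate (Suc k) (block y s)) \<noteq> [] \<and> hd (concat (replicate (Suc k) (block y s))) = y \<and>
      last (concat (replicate (Suc k) (block y s))) = inv_letter s \<and>
      reduced (concat (replicate (Suc k) (block y s)))" for k
    using assms(1)
    by (induction k) (auto simp: reduced_append, auto simp: block_def reduced_def inv_letter_def prod_eq_iff)
  then show "concat (replicate k (block y s)) \<noteq> []" "hd (concat (replicate k (block y s))) = y"
    "last (concat (replicate k (block y s))) = inv_letter s"
    "reduced (concat (replicate k (block y s)))"
    using assms(2) by (metis Suc_pred)+
qed

lemma weight_side: "0 \<le> weight c (side c x w)"
  by (simp add: side_def weight_def)

lemma fst_side [simp]: "fst (side c x w) = x"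
  by (simp add: side_def)

lemma length_add_peak [simp]: "length (add_peak k c s x w) = length w + 4 * k"
  by (simp add: add_peak_def)

lemma add_peak_in_lists:
  assumes "w \<in> lists (letters X)" "x \<in> X" "s \<in> letters X"
  shows "add_peak k c s x w \<in> lists (letters X)"
proof -
  have "side c x w \<in> letters X" using assms by (simp add: side_def letters_def)
  then have "concat (replicate k (block (side c x w) s)) \<in> lists (letters X)"
    using assms(3) by (intro blocks_in_lists) simp
  then show ?thesis
    using assms(1) set_take_subset[of _ w] set_drop_subset[of _ w]
    unfolding add_peak_def in_lists_conv_set by fastforce
qed

lemma height_add_peak [simp]: "height d (add_peak k c s x w) = height d w"
proof -
  have "height d w = height d (take (peak_pos c w) w) + height d (drop (peak_pos c w) w)"
    by (metis append_take_drop_id height_simps(3))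
  then show ?thesis by (simp add: add_peak_def)
qed

lemma peak_add_peak:
  assumes "height c w = 0"
  shows "peak k c s x (add_peak k c s x w)"
  unfolding peak_def add_peak_def
proof (intro exI conjI)
  show "heights c 0 (take (peak_pos c w) w @ drop (peak_pos c w) w) \<subseteq> {..height c (take (peak_pos c w) w)}"
    using peak_pos_max[of c _ w] by (auto simp: heights_eq_image)
  show "height c (take (peak_pos c w) w @ drop (peak_pos c w) w) = 0"
    using assms by (simp only: append_take_drop_id)
qed (auto simp: weight_side)

text \<open>Three junctions matter. The letter before the insertion rises strictly while
  \<open>y\<close> does not descend; the letter after it does not rise and so differs from
  \<open>s\<close>; if nothing precedes the insertion, \<open>y\<close> meets the last letter of
  \<open>w\<close> cyclically, and \<open>side\<close> is chosen to avoid cancellation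
  there.\<close>

lemma cyclically_reduced_add_peak:
  assumes w: "cyclically_reduced w" "w \<noteq> []" "height c w = 0"
    and s: "fst s \<noteq> x" "0 < weight c s" and k: "k > 0"
  shows "cyclically_reduced (add_peak k c s x w)"
proof -
  define p where "p = peak_pos c w"
  define A B y where "A = take p w" and "B = drop p w" and "y = side c x w"
  define D where "D = concat (replicate k (block y s))"
  have p: "p < length w" using peak_pos_less_length[OF w(2,3)] by (simp add: p_def)
  have wAB: "w = A @ B" and B: "B \<noteq> []" using p by (simp_all add: A_def B_def)
  have D: "D \<noteq> []" "hd D = y" "last D = inv_letter s" "reduced D"
    unfolding D_def using blocks[of s y k] s k by (simp_all add: y_def)
  have y: "0 \<le> weight c y" by (simp add: y_def weight_side)
  have "take (Suc p) w = A @ [hd B]"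
    using p by (simp add: A_def B_def take_Suc_conv_app_nth hd_drop_conv_nth)
  then have "weight c (hd B) \<le> 0"
    using peak_pos_max[of c "Suc p" w] by (simp add: p_def[symmetric] A_def[symmetric])
  then have hdB: "hd B \<noteq> s" using s by auto
  have lastA: "y \<noteq> inv_letter (last A)" if "A \<noteq> []"
  proof -
    have "A = take (p - 1) w @ [last A]"
      using that p by (metis A_def append_butlast_last_id butlast_take less_imp_le)
    moreover have "height c (take (p - 1) w) < height c A"
      using that peak_pos_first[of "p - 1" c w] by (cases p) (auto simp: p_def[symmetric] A_def)
    ultimately have "0 < weight c (last A)"
      by (metis add.right_neutral height_simps less_add_same_cancel1)
    then show ?thesis using y by auto
  qed
  have lastw: "y \<noteq> inv_letter (last w)" if "A = []"
  proof (cases "c x = 0")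
    case True
    then show ?thesis by (auto simp: y_def side_def inv_letter_def)
  next
    case False
    have "w = take (length w - 1) w @ [last w]"
      using w(2) by (metis append_butlast_last_id butlast_conv_take)
    then have "0 = height c (take (length w - 1) w) + weight c (last w)"
      using w(3) by (metis add.right_neutral height_simps)
    moreover have "height c (take (length w - 1) w) \<le> 0"
      using peak_pos_max[of c "length w - 1" w] that by (simp add: p_def[symmetric] A_def[symmetric])
    moreover have "0 < weight c y" using False by (auto simp: y_def side_def weight_def)
    ultimately show ?thesis by auto
  qed
  have "reduced (A @ B)" and cyc: "hd (A @ B) \<noteq> inv_letter (last (A @ B))"
    using w wAB by (auto simp: cyclically_reduced_def)
  then have "reduced (A @ D @ B)"
    using D B hdB lastA by (auto simp: reduced_append)
  moreover have "hd (A @ D @ B) \<noteq> inv_letter (last (A @ D @ B))"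
    using cyc D B lastw wAB by (cases "A = []") auto
  ultimately show ?thesis
    by (simp add: add_peak_def cyclically_reduced_def A_def B_def D_def p_def y_def)
qed

text \<open>The letters \<open>y\<close> and \<open>s\<close> of the first commutator climb from the
  old maximum to the new one, hence the shift by 2.\<close>

lemma peak_pos_add_peak:
  assumes s: "0 < weight c s" and k: "k > 0" and w: "height c w = 0"
  shows "peak_pos c (add_peak k c s x w) = peak_pos c w + 2"
proof -
  define p where "p = peak_pos c w"
  define A B y where "A = take p w" and "B = drop p w" and "y = side c x w"
  define D where "D = concat (replicate k (block y s))"
  have y: "0 \<le> weight c y" by (simp add: y_def weight_side)
  have pl: "p \<le> length w"
    using peak_pos_less_length[OF _ w] peak_pos_first[of 0 c w] by (cases "w = []") (auto simp: p_def)
  then have lA: "length A = p" by (simp add: A_def)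
  have add_peak: "add_peak k c s x w = A @ D @ B" by (simp add: add_peak_def A_def B_def D_def p_def y_def)
  obtain D' where D': "D = y # s # D'" using k by (cases k) (auto simp: D_def block_def)
  have top: "height c (take (p + 2) (A @ D @ B)) = height c A + weight c y + weight c s"
    using lA by (simp add: D' numeral_2_eq_2)
  have max: "height c (take j w) \<le> height c A" for j
    using peak_pos_max[of c j w] by (simp add: A_def p_def)
  have "heights c 0 (A @ D @ B) = heights c 0 w \<union> heights c (height c A) D"
    by (subst heights_insert) (simp_all add: D_def A_def B_def)
  also have "\<dots> \<subseteq> {..height c A + weight c y + weight c s}"
  proof (rule Un_least)
    show "heights c 0 w \<subseteq> {..height c A + weight c y + weight c s}"
      using s y by (auto simp: heights_eq_image intro!: order_trans[OF max])
    have "heights c (height c A) D \<subseteq> {height c A..height c A + weight c y + weight c s}"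
      unfolding D_def using s y by (intro heights_blocks_le) auto
    then show "heights c (height c A) D \<subseteq> {..height c A + weight c y + weight c s}" by auto
  qed
  finally have "height c (take j (A @ D @ B)) \<le> height c A + weight c y + weight c s" for j
    by (auto simp: heights_eq_image)
  moreover have "height c (take j (A @ D @ B)) < height c A + weight c y + weight c s" if "j < p + 2" for j
  proof (cases "j = p + 1")
    case True
    then show ?thesis using lA s by (simp add: D')
  next
    case False
    then have "take j (A @ D @ B) = take j w" using that lA by (simp add: A_def)
    then show ?thesis using max[of j] s y by simp
  qed
  ultimately show ?thesis
    unfolding add_peak p_def[symmetric] top[symmetric] by (intro peak_pos_eqI) auto
qed

text \<open>The first maximum of the result reveals the insertion point, where \<open>4 * k\<close>
  letters are then deleted.\<close>

lemma add_peak_inject: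
  assumes "0 < weight c s" "k > 0" "height c v = 0" "height c w = 0"
    and eq: "add_peak k c s x v = add_peak k c s x w"
  shows "v = w"
proof -
  have recover: "u = take (peak_pos c u) (add_peak k c s x u) @ drop (peak_pos c u + 4 * k) (add_peak k c s x u)"
    if "height c u = 0" for u
  proof -
    have "peak_pos c u \<le> length u"
      using peak_pos_less_length[OF _ that] peak_pos_first[of 0 c u] by (cases "u = []") auto
    then show ?thesis by (simp add: add_peak_def)
  qed
  have "peak_pos c v = peak_pos c w"
    using peak_pos_add_peak[of c s k v x] peak_pos_add_peak[of c s k w x] assms by simp
  then show ?thesis using recover[of v] recover[of w] assms by metis
qed

text \<open>An insertion at the first minimum never rises above its starting point, so it creates no
  new maximum. It remains to see that it does not split the commutator at the top.\<close>

lemma peak_add_peak_opposite: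
  assumes w: "peak 1 c s x w" and s: "0 < weight c s"
    and s': "0 < weight c (inv_letter s')"
  shows "peak 1 c s x (add_peak k (\<lambda>x. - c x) s' z w)"
proof -
  obtain A B y where wA: "w = A @ block y s @ B" and y: "fst y = x" "0 \<le> weight c y"
    and hts: "heights c 0 (A @ B) \<subseteq> {..height c A}" and h0: "height c (A @ B) = 0"
    using w by (auto simp: peak_def)
  define q where "q = peak_pos (\<lambda>x. - c x) w"
  define D where "D = concat (replicate k (block (side (\<lambda>x. - c x) z w) s'))"
  have min: "height c (take q w) \<le> height c (take j w)" for j
    using peak_pos_max[of "\<lambda>x. - c x" j w] by (simp add: q_def)
  have first: "height c (take q w) < height c (take j w)" if "j < q" for j
    using peak_pos_first[of j "\<lambda>x. - c x" w] that by (simp add: q_def)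
  have hD: "height c D = 0" by (simp add: D_def)
  have heights_D: "heights c h D \<subseteq> {..h}" for h
  proof -
    have "heights (\<lambda>x. - c x) (- h) D \<subseteq> {- h..}"
      using heights_blocks_le[of "\<lambda>x. - c x" "side (\<lambda>x. - c x) z w" s' "- h" k] s'
        weight_side[of "\<lambda>x. - c x" z w]
      unfolding D_def by auto
    then show ?thesis by (auto simp: heights_uminus)
  qed
  have le: "height c (take q w) \<le> height c A" using min[of "length A"] by (simp add: wA)
  have add_peak: "add_peak k (\<lambda>x. - c x) s' z w = take q w @ D @ drop q w"
    by (simp add: add_peak_def q_def D_def)
  \<comment> \<open>Strictly inside the commutator the height is at least that at its start, so the
    first minimum cannot lie there.\<close>
  have "q \<le> length A \<or> length A + 4 \<le> q"
  proof (rule ccontr)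
    assume "\<not> ?thesis"
    then consider "q = length A + 1" | "q = length A + 2" | "q = length A + 3" by linarith
    then show False
    proof cases
      case 1
      then show False using first[of "length A"] y by (simp add: wA block_def)
    qed (use le s y in \<open>simp_all add: wA block_def numeral_2_eq_2 numeral_3_eq_3\<close>)
  qed
  then show ?thesis
  proof
    assume q: "q \<le> length A"
    let ?A = "take q A @ D @ drop q A"
    have "height c (take q A) \<le> height c A" using le q by (simp add: wA)
    then have "heights c (height c (take q A)) D \<subseteq> {..height c A}"
      using order_trans[OF heights_D] by simp
    moreover have id: "take q A @ drop q A @ B = A @ B" by (metis append.assoc append_take_drop_id)
    have "heights c 0 (?A @ B) = heights c 0 (A @ B) \<union> heights c (height c (take q A)) D"
      using heights_insert[OF hD, of 0 "take q A" "drop q A @ B"] unfolding id by simp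
    ultimately have "heights c 0 (?A @ B) \<subseteq> {..height c A}" using hts by simp
    moreover have "height c ?A = height c A"
      using hD by (metis add.left_neutral append_take_drop_id height_simps(3))
    moreover have "add_peak k (\<lambda>x. - c x) s' z w = ?A @ concat (replicate 1 (block y s)) @ B"
      unfolding add_peak using q by (simp add: wA)
    ultimately show ?thesis
      unfolding peak_def using y h0 by (intro exI[of _ ?A] exI[of _ B] exI[of _ y]) auto
  next
    assume q: "length A + 4 \<le> q"
    define j where "j = q - (length A + 4)"
    have q': "q = length A + length (block y s) + j" using q by (simp add: j_def block_def)
    let ?B = "take j B @ D @ drop j B"
    have tq: "take q w = A @ block y s @ take j B" "drop q w = drop j B"
      by (simp_all add: wA q')
    have "height c (A @ take j B) \<le> height c A" using le by (simp add: tq)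
    then have "heights c (height c (A @ take j B)) D \<subseteq> {..height c A}"
      by (intro order_trans[OF heights_D]) simp
    moreover have "heights c 0 (A @ ?B) = heights c 0 (A @ B) \<union> heights c (height c (A @ take j B)) D"
      using heights_insert[OF hD, of 0 "A @ take j B" "drop j B"] by simp
    ultimately have "heights c 0 (A @ ?B) \<subseteq> {..height c A}" using hts by simp
    moreover have "height c ?B = height c B"
      using hD by (metis add.left_neutral append_take_drop_id height_simps(3))
    moreover have "add_peak k (\<lambda>x. - c x) s' z w = A @ concat (replicate 1 (block y s)) @ ?B"
      unfolding add_peak tq by simp
    ultimately show ?thesis
      unfolding peak_def using y h0 by (intro exI[of _ A] exI[of _ ?B] exI[of _ y]) auto
  qed
qed

section \<open>Counting presentations\<close>

text \<open>Gaussian elimination without division: an equation \<open>a\<close> with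
  \<open>a z \<noteq> 0\<close> eliminates the unknown \<open>z\<close>, which leaves one equation
  and one unknown less.\<close>

lemma integer_kernel:
  fixes As :: "('x \<Rightarrow> int) list"
  assumes "finite X" "length As < card X"
  shows "\<exists>c. (\<exists>x\<in>X. c x \<noteq> 0) \<and> (\<forall>a\<in>set As. (\<Sum>x\<in>X. c x * a x) = 0)"
  using assms
proof (induction As arbitrary: X rule: length_induct)
  case (1 As)
  show ?case
  proof (cases As)
    case Nil
    then have "X \<noteq> {}" using 1 by auto
    then show ?thesis using Nil by (intro exI[of _ "\<lambda>_. 1"]) auto
  next
    case (Cons a As')
    show ?thesis
    proof (cases "\<forall>x\<in>X. a x = 0")
      case True
      then have "\<exists>c. (\<exists>x\<in>X. c x \<noteq> 0) \<and> (\<forall>a\<in>set As'. (\<Sum>x\<in>X. c x * a x) = 0)"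
        using 1 Cons by simp
      then show ?thesis using True Cons by auto
    next
      case False
      then obtain z where z: "z \<in> X" "a z \<noteq> 0" by blast
      define red where "red b x = a z * b x - b z * a x" for b x
      have "\<exists>c. (\<exists>x\<in>X - {z}. c x \<noteq> 0) \<and> (\<forall>b\<in>set (map red As'). (\<Sum>x\<in>X - {z}. c x * b x) = 0)"
        using 1(1)[rule_format, of "map red As'" "X - {z}"] 1(2,3) Cons z by simp
      then obtain c where c: "\<exists>x\<in>X - {z}. c x \<noteq> 0"
          "\<And>b. b \<in> set As' \<Longrightarrow> (\<Sum>x\<in>X - {z}. c x * red b x) = 0"
        by auto
      define T where "T b = (\<Sum>x\<in>X - {z}. c x * b x)" for b
      \<comment> \<open>Scaling by \<open>a z\<close> allows the equation \<open>a\<close> to be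
        solved for the coordinate \<open>z\<close> within the integers.\<close>
      define d where "d x = (if x = z then - T a else a z * c x)" for x
      have sum_d: "(\<Sum>x\<in>X. d x * b x) = - T a * b z + a z * T b" for b
      proof -
        have "(\<Sum>x\<in>X - {z}. d x * b x) = (\<Sum>x\<in>X - {z}. a z * (c x * b x))"
          by (intro sum.cong) (auto simp: d_def)
        then show ?thesis
          using 1(2) z by (simp add: sum.remove[of X z] d_def T_def sum_distrib_left)
      qed
      have "a z * T b - b z * T a = 0" if "b \<in> set As'" for b
        using c(2)[OF that]
        by (simp add: T_def red_def sum_distrib_left sum_subtractf algebra_simps)
      then have "- T a * b z + a z * T b = 0" if "b \<in> set As" for b
        using that Cons by (auto simp: algebra_simps)
      then have "\<forall>b\<in>set As. (\<Sum>x\<in>X. d x * b x) = 0" unfolding sum_d by blast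
      moreover have "\<exists>x\<in>X. d x \<noteq> 0" using c(1) z by (auto simp: d_def)
      ultimately show ?thesis by blast
    qed
  qed
qed

text \<open>The inner height is the exponent sum of \<open>x\<close> in \<open>w\<close>; so a
  grading kills \<open>w\<close> if it solves one linear equation.\<close>

lemma height_sum:
  assumes "finite X" "w \<in> lists (letters X)"
  shows "height c w = (\<Sum>x\<in>X. c x * height (\<lambda>y. if y = x then 1 else 0) w)"
  using assms(2)
proof (induction w rule: list.induct)
  case (Cons a w)
  then have "fst a \<in> X" by (auto simp: letters_def)
  then have "(\<Sum>x\<in>X. c x * weight (\<lambda>y. if y = x then 1 else 0) a) = weight c a"
    using assms(1) by (auto simp: weight_def if_distrib sum.delta cong: if_cong)
  then show ?case
    using Cons by (simp add: distrib_left sum.distrib)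
qed simp

text \<open>The choice depends only on the functionals sending a grading to the heights of the
  relators, not on the relators themselves. Inserting commutators preserves these functionals, so
  the same pair is chosen before and after.\<close>

definition grading :: "'x set \<Rightarrow> (('x \<Rightarrow> int) \<Rightarrow> int) list \<Rightarrow> ('x \<Rightarrow> int) \<times> 'x" where
  "grading X hs = (SOME (c, t). t \<in> X \<and> 0 < c t \<and> (\<forall>h\<in>set hs. h c = 0))"

lemma grading:
  assumes "finite X" "length rs < card X" "set rs \<subseteq> lists (letters X)"
    and "grading X (map (\<lambda>w c. height c w) rs) = (c, t)"
  shows "t \<in> X" "0 < c t" "\<And>w. w \<in> set rs \<Longrightarrow> height c w = 0"
proof -
  define As where "As = map (\<lambda>w x. height (\<lambda>y. if y = x then 1 else 0) w) rs"
  obtain c' where c': "\<exists>x\<in>X. c' x \<noteq> 0" "\<And>a. a \<in> set As \<Longrightarrow> (\<Sum>x\<in>X. c' x * a x) = 0"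
    using integer_kernel[OF assms(1), of As] assms(2) by (auto simp: As_def)
  then obtain x where x: "x \<in> X" "c' x \<noteq> 0" by blast
  have "height c' w = 0" if "w \<in> set rs" for w
  proof -
    have "w \<in> lists (letters X)" using that assms(3) by blast
    then have "height c' w = (\<Sum>x\<in>X. c' x * height (\<lambda>y. if y = x then 1 else 0) w)"
      by (rule height_sum[OF assms(1)])
    also have "\<dots> = 0" using that by (intro c'(2)) (auto simp: As_def)
    finally show ?thesis .
  qed
  then have "\<forall>w\<in>set rs. height (if 0 < c' x then c' else (\<lambda>x. - c' x)) w = 0"
    by simp
  moreover have "0 < (if 0 < c' x then c' else (\<lambda>x. - c' x)) x" using x by simp
  ultimately have "(\<lambda>(c, t). t \<in> X \<and> 0 < c t \<and> (\<forall>h\<in>set (map (\<lambda>w c. height c w) rs). h c = 0))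
      (if 0 < c' x then c' else (\<lambda>x. - c' x), x)"
    using x(1) by simp
  then have "(\<lambda>(c, t). t \<in> X \<and> 0 < c t \<and> (\<forall>h\<in>set (map (\<lambda>w c. height c w) rs). h c = 0))
      (grading X (map (\<lambda>w c. height c w) rs))"
    unfolding grading_def by (rule someI)
  then have "t \<in> X \<and> 0 < c t \<and> (\<forall>w\<in>set rs. height c w = 0)"
    unfolding assms(4) by simp
  then show "t \<in> X" "0 < c t" "\<And>w. w \<in> set rs \<Longrightarrow> height c w = 0" by blast+
qed

text \<open>The \<open>i\<close>-th element of \<open>{1..n + 1} - {t}\<close>, where \<open>i < n\<close>.\<close>

definition nth_other :: "nat \<Rightarrow> nat \<Rightarrow> nat" where
  "nth_other t i = (if i + 1 < t then i + 1 else i + 2)"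

text \<open>The top comes first because the insertion at the minimum is known to preserve it.
  Injectivity follows by undoing the two insertions in reverse order.\<close>

definition add_extrema :: "('x \<Rightarrow> int) \<Rightarrow> 'x \<Rightarrow> 'x \<Rightarrow> 'x word \<Rightarrow> 'x word" where
  "add_extrema c t x w = add_peak 2 (\<lambda>x. - c x) (t, False) x (add_peak 1 c (t, True) x w)"

definition add_extrema_all :: "nat \<Rightarrow> nat word list \<Rightarrow> nat word list" where
  "add_extrema_all n rs = (let (c, t) = grading {1..n + 1} (map (\<lambda>w c. height c w) rs)
     in map (\<lambda>i. add_extrema c t (nth_other t i) (rs ! i)) [0..<n])"

lemma add_extrema_all_eq:
  assumes "grading {1..n + 1} (map (\<lambda>w c. height c w) rs) = (c, t)"
  shows "add_extrema_all n rs = map (\<lambda>i. add_extrema c t (nth_other t i) (rs ! i)) [0..<n]"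
  unfolding add_extrema_all_def assms by simp

lemma nth_other: "t \<in> {1..n + 1} \<Longrightarrow> bij_betw (nth_other t) {0..<n} ({1..n + 1} - {t})"
proof -
  assume t: "t \<in> {1..n + 1}"
  have "x \<in> nth_other t ` {0..<n}" if "x \<in> {1..n + 1} - {t}" for x
    using t that by (intro image_eqI[of _ _ "if x < t then x - 1 else x - 2"]) (auto simp: nth_other_def)
  moreover have "nth_other t ` {0..<n} \<subseteq> {1..n + 1} - {t}"
    using t by (auto simp: nth_other_def)
  ultimately have "nth_other t ` {0..<n} = {1..n + 1} - {t}" by blast
  moreover have "inj_on (nth_other t) {0..<n}"
    by (auto simp: inj_on_def nth_other_def split: if_splits)
  ultimately show ?thesis by (simp add: bij_betw_def)
qed

lemma weights_t [simp]: "weight c (t, True) = c t" "weight c (t, False) = - c t"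
  by (simp_all add: weight_def)

lemma add_extrema:
  assumes "0 < c t" "x \<noteq> t" "height c w = 0"
  shows "peak 1 c (t, True) x (add_extrema c t x w)"
    and "peak 2 (\<lambda>x. - c x) (t, False) x (add_extrema c t x w)"
    and "cyclically_reduced w \<Longrightarrow> w \<noteq> [] \<Longrightarrow> cyclically_reduced (add_extrema c t x w)"
proof -
  show "peak 1 c (t, True) x (add_extrema c t x w)"
    unfolding add_extrema_def
    using assms by (intro peak_add_peak_opposite peak_add_peak) (simp_all add: inv_letter_def)
  show "peak 2 (\<lambda>x. - c x) (t, False) x (add_extrema c t x w)"
    unfolding add_extrema_def using assms by (intro peak_add_peak) simp
  assume w: "cyclically_reduced w" "w \<noteq> []"
  have "length (add_peak 1 c (t, True) x w) \<noteq> 0" by simp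
  then have "add_peak 1 c (t, True) x w \<noteq> []" by (metis list.size(3))
  then show "cyclically_reduced (add_extrema c t x w)"
    unfolding add_extrema_def using assms w by (intro cyclically_reduced_add_peak) simp_all
qed

lemma add_extrema_inject:
  assumes "0 < c t" "height c v = 0" "height c w = 0" "add_extrema c t x v = add_extrema c t x w"
  shows "v = w"
  using assms unfolding add_extrema_def
  by (intro add_peak_inject[of c "(t, True)" 1 v w x]
      add_peak_inject[of "\<lambda>x. - c x" "(t, False)" 2 "add_peak 1 c (t, True) x v" "add_peak 1 c (t, True) x w" x])
    simp_all

lemma add_extrema_relators:
  assumes "0 < c t" "x \<noteq> t" "height c w = 0" "w \<in> relators m l" "x \<in> {1..m}" "t \<in> {1..m}"
  shows "add_extrema c t x w \<in> relators m (l + 12)"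
proof -
  have "add_extrema c t x w \<in> lists (letters {1..m})"
    unfolding add_extrema_def using assms by (intro add_peak_in_lists) (simp_all add: relators_def letters_def)
  moreover have "length (add_extrema c t x w) = length w + 12" by (simp add: add_extrema_def)
  ultimately show ?thesis
    using assms add_extrema(3)[OF assms(1-3)] by (auto simp: relators_def)
qed

section \<open>The modification of whole presentations\<close>

context
  fixes n :: nat and l :: nat
  assumes n: "n \<ge> 1"
begin

lemma grading_presentations:
  assumes rs: "rs \<in> presentations (n + 1) n l"
    and g: "grading {1..n + 1} (map (\<lambda>w c. height c w) rs) = (c, t)"
  shows "t \<in> {1..n + 1}" "0 < c t" "\<And>i. i < n \<Longrightarrow> height c (rs ! i) = 0"
    and "\<And>i. i < n \<Longrightarrow> nth_other t i \<noteq> t" "\<And>i. i < n \<Longrightarrow> nth_other t i \<in> {1..n + 1}"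
proof -
  have "length rs = n" "set rs \<subseteq> lists (letters {1..n + 1})"
    using rs by (auto simp: presentations_def relators_def)
  with g show t: "t \<in> {1..n + 1}" "0 < c t" "\<And>i. i < n \<Longrightarrow> height c (rs ! i) = 0"
    using grading[of "{1..n + 1}" rs c t] by auto
  fix i assume "i < n"
  then have "nth_other t i \<in> {1..n + 1} - {t}"
    using bij_betwE[OF nth_other[OF t(1)]] by simp
  then show "nth_other t i \<noteq> t" "nth_other t i \<in> {1..n + 1}" by auto
qed

lemma add_extrema_all_presentations:
  assumes rs: "rs \<in> presentations (n + 1) n l"
  shows "add_extrema_all n rs \<in> presentations (n + 1) n (l + 12)"
proof -
  obtain c t where g: "grading {1..n + 1} (map (\<lambda>w c. height c w) rs) = (c, t)" by fastforce
  note * = grading_presentations[OF rs g]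
  have "add_extrema c t (nth_other t i) (rs ! i) \<in> relators (n + 1) (l + 12)" if "i < n" for i
    using * that rs by (intro add_extrema_relators) (auto simp: presentations_def)
  then show ?thesis by (auto simp: add_extrema_all_eq[OF g] presentations_def)
qed

lemma add_extrema_all_inject: "inj_on (add_extrema_all n) (presentations (n + 1) n l)"
proof (rule inj_onI)
  fix rs qs assume rs: "rs \<in> presentations (n + 1) n l" and qs: "qs \<in> presentations (n + 1) n l"
    and eq: "add_extrema_all n rs = add_extrema_all n qs"
  have len: "length rs = n" "length qs = n" using rs qs by (auto simp: presentations_def)
  \<comment> \<open>Equal results have equal height functionals, so \<open>grading\<close> chose the
    same \<open>c\<close> and \<open>t\<close> for \<open>rs\<close> and \<open>qs\<close>, and
    relators can be compared one by one.\<close>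
  have hs: "map (\<lambda>w c. height c w) (add_extrema_all n ps) = map (\<lambda>w c. height c w) ps"
    if "length ps = n" for ps
    using that by (auto simp: add_extrema_all_def add_extrema_def split_beta Let_def intro!: nth_equalityI)
  obtain c t where g: "grading {1..n + 1} (map (\<lambda>w c. height c w) rs) = (c, t)" by fastforce
  have g': "grading {1..n + 1} (map (\<lambda>w c. height c w) qs) = (c, t)"
    using g hs[OF len(1)] hs[OF len(2)] eq by simp
  show "rs = qs"
  proof (rule nth_equalityI)
    fix i assume "i < length rs"
    then have i: "i < n" by (simp add: len)
    have "add_extrema_all n rs ! i = add_extrema_all n qs ! i" by (simp add: eq)
    then have "add_extrema c t (nth_other t i) (rs ! i) = add_extrema c t (nth_other t i) (qs ! i)"
      using i by (simp add: add_extrema_all_eq[OF g] add_extrema_all_eq[OF g'])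
    then show "rs ! i = qs ! i"
      using grading_presentations[OF rs g] grading_presentations[OF qs g'] i by (blast intro: add_extrema_inject)
  qed (simp add: len)
qed

lemma add_extrema_all_not_separable:
  assumes rs: "rs \<in> presentations (n + 1) n l"
  shows "\<not> subgroup_separable (presented_group {1..n + 1} (set (add_extrema_all n rs)))"
proof -
  obtain c t where g: "grading {1..n + 1} (map (\<lambda>w c. height c w) rs) = (c, t)" by fastforce
  note * = grading_presentations[OF rs g]
  \<comment> \<open>The relators are reindexed by the generators they are paired with, as the locale
    expects.\<close>
  define r where "r x = add_extrema c t x (rs ! the_inv_into {0..<n} (nth_other t) x)" for x
  have bij: "bij_betw (nth_other t) {0..<n} ({1..n + 1} - {t})" by (rule nth_other[OF *(1)])
  have r_nth_other: "r (nth_other t i) = add_extrema c t (nth_other t i) (rs ! i)" if "i < n" for i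
    using that bij by (simp add: r_def the_inv_into_f_f bij_betw_def)
  have img: "{1..n + 1} - {t} = nth_other t ` {0..<n}" using bij by (simp add: bij_betw_def)
  have relators: "set (add_extrema_all n rs) = r ` ({1..n + 1} - {t})"
    unfolding img image_image using r_nth_other by (auto simp: add_extrema_all_eq[OF g])
  interpret peaked_presentation "{1..n + 1}" t c r
  proof
    fix x assume "x \<in> {1..n + 1} - {t}"
    then have "x \<in> nth_other t ` {0..<n}" by (simp only: img)
    then obtain i where i: "i < n" "x = nth_other t i" by auto
    have "add_extrema_all n rs ! i \<in> relators (n + 1) (l + 12)"
      using add_extrema_all_presentations[OF rs] i(1) by (auto simp: presentations_def)
    then have "r x \<in> relators (n + 1) (l + 12)"
      using i r_nth_other by (simp add: add_extrema_all_eq[OF g])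
    then show "r x \<in> carrier (free_group {1..n + 1})"
      using relators_subset_free_group by blast
    show "peak 1 c (t, True) x (r x)" "peak 2 (\<lambda>x. - c x) (t, False) x (r x)"
      unfolding i(2) r_nth_other[OF i(1)] using * i(1) by (blast intro: add_extrema)+
  next
    have "card {1..n + 1} \<noteq> card {t}" using n by simp
    then show "{1..n + 1} \<noteq> {t}" by metis
  qed (use * in auto)
  show ?thesis using not_subgroup_separable unfolding R_def relators .
qed

end

section \<open>Growth of the number of presentations\<close>

lemma finite_relators: "finite (relators m l)"
proof (rule finite_subset)
  show "relators m l \<subseteq> {w. set w \<subseteq> letters {1..m} \<and> length w \<le> l}"
    by (auto simp: relators_def)
  show "finite {w. set w \<subseteq> letters {1..m} \<and> length w \<le> l}"
    by (intro finite_lists_length_le) (simp add: letters_def)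
qed

lemma card_presentations: "card (presentations m n l) = card (relators m l) ^ n"
  using card_lists_length_eq[OF finite_relators, of m l n]
  by (simp add: presentations_def conj_commute)

lemma exists_letter:
  fixes m :: nat
  assumes "m \<ge> 2"
  obtains a where "a \<in> letters {1..m}" "a \<noteq> p" "a \<noteq> q"
proof -
  have "card (letters {1..m}) = 2 * m" by (simp add: letters_def card_cartesian_product)
  moreover have "card {p, q} \<le> 2" by (simp add: card_insert_if)
  moreover have "finite {p, q}" by simp
  ultimately have "\<not> letters {1..m} \<subseteq> {p, q}"
    using assms card_mono[of "{p, q}" "letters {1..m}"] by linarith
  then show ?thesis using that by blast
qed

text \<open>
  A cyclically reduced word of length \<open>l + 1\<close> is turned into one of length \<open>l\<close> by replacing its
  last two letters by a suitable single one.
\<close>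

lemma card_relators_Suc:
  assumes m: "m \<ge> 2" and l: "l \<ge> 1"
  shows "card (relators m (Suc l)) \<le> (1 + 4 * m\<^sup>2) * card (relators m l)"
proof -
  let ?L = "letters {1..m}" and ?C = "relators m l"
  define ext where "ext = (\<lambda>(w::nat word, a, b). butlast w @ [a, b])"
  have fin: "finite ?L" "finite ?C" by (simp_all add: letters_def finite_relators)
  have "w \<in> ext ` (?C \<times> ?L \<times> ?L)" if w: "w \<in> relators m (Suc l)" "w \<notin> ?C" for w
  proof -
    have len: "length w = Suc l" using w by (auto simp: relators_def)
    define u where "u = take (l - 1) w"
    have "length (drop (l - 1) w) = 2" using len l by simp
    then obtain a b where "drop (l - 1) w = [a, b]"
      unfolding numeral_2_eq_2 length_Suc_conv by auto
    then have uab: "w = u @ [a, b]" by (metis append_take_drop_id u_def)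
    have *: "u \<in> lists ?L" "a \<in> ?L" "b \<in> ?L" "reduced u"
      using w(1) by (auto simp: relators_def uab cyclically_reduced_def reduced_append)
    \<comment> \<open>The new letter must cancel neither with the letter before it nor, cyclically,
      with the first one. For empty \<open>u\<close> both are unspecified values, and any one-letter
      word will do.\<close>
    obtain d where d: "d \<in> ?L" "d \<noteq> inv_letter (last u)" "d \<noteq> inv_letter (hd u)"
      using exists_letter[OF m] by blast
    have "hd u \<noteq> inv_letter d" using d(3) by auto
    then have "u @ [d] \<in> ?C"
      using * d len by (auto simp: relators_def uab cyclically_reduced_def reduced_append hd_append,
          simp_all add: reduced_def)
    then show ?thesis
      using * by (intro image_eqI[of _ _ "(u @ [d], a, b)"]) (auto simp: ext_def uab)
  qed
  then have "relators m (Suc l) \<subseteq> ?C \<union> ext ` (?C \<times> ?L \<times> ?L)" by blast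
  then have "card (relators m (Suc l)) \<le> card (?C \<union> ext ` (?C \<times> ?L \<times> ?L))"
    using fin by (intro card_mono) auto
  also have "\<dots> \<le> card ?C + card (ext ` (?C \<times> ?L \<times> ?L))"
    by (rule card_Un_le)
  also have "card (ext ` (?C \<times> ?L \<times> ?L)) \<le> card (?C \<times> ?L \<times> ?L)"
    using fin by (intro card_image_le) simp
  also have "card (?C \<times> ?L \<times> ?L) = 4 * m\<^sup>2 * card ?C"
    by (simp add: card_cartesian_product letters_def power2_eq_square)
  finally show ?thesis by (simp add: algebra_simps)
qed

lemma card_relators_add:
  assumes "m \<ge> 2" "l \<ge> 1"
  shows "card (relators m (l + k)) \<le> (1 + 4 * m\<^sup>2) ^ k * card (relators m l)"
proof (induction k)
  case (Suc k)
  have "card (relators m (l + Suc k)) \<le> (1 + 4 * m\<^sup>2) * card (relators m (l + k))"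
    using card_relators_Suc[of m "l + k"] assms by simp
  also have "\<dots> \<le> (1 + 4 * m\<^sup>2) * ((1 + 4 * m\<^sup>2) ^ k * card (relators m l))"
    by (intro mult_left_mono Suc) simp
  finally show ?case by (simp add: algebra_simps)
qed simp

lemma relators_nonempty:
  assumes "m \<ge> 1" "l \<ge> 1"
  shows "relators m l \<noteq> {}"
proof -
  have "[(1, True)] \<in> relators m l"
    using assms by (simp add: relators_def cyclically_reduced_def reduced_def letters_def inv_letter_def)
  then show ?thesis by blast
qed

text \<open>The presentations with length bound \<open>l - 12\<close> embed into the nonseparable
  ones with bound \<open>l\<close>, and they number at least a fixed fraction of all presentations
  with bound \<open>l\<close>.\<close>

theorem theoremC:
  fixes n :: nat
  assumes "n \<ge> 1"
  shows "liminf (\<lambda>l. ereal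
      (real (card {rs \<in> presentations (n + 1) n l.
                   \<not> subgroup_separable (presented_group {1..n + 1} (set rs))})
       / real (card (presentations (n + 1) n l)))) > 0"
proof -
  let ?P = "presentations (n + 1) n"
  define bad where "bad l = {rs \<in> ?P l. \<not> subgroup_separable (presented_group {1..n + 1} (set rs))}" for l
  \<comment> \<open>Each of the \<open>n\<close> relators gains 12 letters, and each letter costs a
    factor of at most \<open>1 + 4 * (n + 1)\<^sup>2\<close>.\<close>
  define K where "K = ((1 + 4 * (n + 1)\<^sup>2) ^ 12) ^ n"
  have "K > 0" by (simp add: K_def)
  have ratio: "1 / real K \<le> real (card (bad l)) / real (card (?P l))" if l: "l \<ge> 13" for l
  proof -
    define j where "j = l - 12"
    have j: "l = j + 12" "j \<ge> 1" using l by (simp_all add: j_def)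
    have "card (?P j) = card (add_extrema_all n ` ?P j)"
      using add_extrema_all_inject[OF assms, of j] by (simp add: card_image)
    also have "\<dots> \<le> card (bad l)"
      using add_extrema_all_presentations[OF assms, of _ j] add_extrema_all_not_separable[OF assms, of _ j]
        finite_presentations[of "n + 1" n l]
      by (intro card_mono) (auto simp: bad_def j)
    finally have "card (?P j) \<le> card (bad l)" .
    moreover have "card (?P l) \<le> K * card (?P j)"
      using power_mono[OF card_relators_add[of "n + 1" j 12], of n] assms j
      by (simp add: card_presentations K_def power_mult_distrib)
    ultimately have "card (?P l) \<le> K * card (bad l)"
      by (meson le_trans mult_le_mono2)
    then have "real (card (?P l)) \<le> real K * real (card (bad l))"
      by (metis of_nat_le_iff of_nat_mult)
    moreover have "card (?P l) > 0"
      using relators_nonempty[of "n + 1" l] l finite_relators[of "n + 1" l]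
      by (simp add: card_presentations card_gt_0_iff)
    ultimately show ?thesis
      using \<open>K > 0\<close> by (simp add: field_simps)
  qed
  have "0 < ereal (1 / real K)" using \<open>K > 0\<close> by simp
  also have "ereal (1 / real K) \<le> liminf (\<lambda>l. ereal (real (card (bad l)) / real (card (?P l))))"
    using ratio by (intro Liminf_bounded eventually_sequentiallyI[of 13]) simp
  finally show ?thesis by (simp add: bad_def)
qed

end
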